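(* Let $c>0$, $0<r<1$, and $\Gamma_1=\Gamma_2=\Gamma_3=\Gamma_4=\pm1$. Consider the relative equilibrium of an equilateral triangle with center, in which vortices $1,2,3$ are at the vertices of an equilateral triangle centered at the origin with circumradius $r$ and vortex $4$ is at the origin, i.e. the fixed point $\mu_0$ of the four-vortex relative dynamics given by $$\mu_1=\mu_2=\mu_3=r^2,\quad \mu_4=0,\quad \overline{\mu_{12}}=\overline{\mu_{23}}=\mu_{13}=r^2e^{2\pi\mathrm i/3},\quad \mu_{14}=\mu_{24}=\mu_{34}=0.$$ This relative equilibrium is (Lyapunov) stable if $$F_6(c,r)=2r^4-c(1-r^2)(2-3r^2)<0.$$
   Context: Let $N=4$ and $D_\Gamma=\operatorname{diag}(\Gamma_1,\dots,\Gamma_4)$. $\mathfrak u(N)$ denotes the real vector space of $N\times N$ complex skew-Hermitian matrices, with inner product $\langle\xi,\eta\rangle=\frac12\operatorname{tr}(\xi^*\eta)$. For smooth $f$ on an open subset of $\mathfrak u(N)$, $\frac{\delta f}{\delta\mu}\in\mathfrak u(N)$ is defined by $\langle\nu,\frac{\delta f}{\delta\mu}\rangle=\frac{d}{ds}\big|_{s=0}f(\mu+s\nu)$ for all $\nu\in\mathfrak u(N)$. Write $\mu=\mathrm iM$ with $M$ Hermitian, with diagonal entries $\mu_i\in\mathbb R$ and above-diagonal entries $\mu_{ij}\in\mathbb C$ ($i<j$); vortices at $z_1,\dots,z_N$ in the open unit disc of $\mathbb C$ correspond to $\mu=\mathrm izz^*$, i.e. $\mu_i=|z_i|^2$ and $\mu_{ij}=z_i\overline{z_j}$.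 The relative dynamics is the Lie–Poisson equation $$\dot\mu=D_\Gamma^{-1}\frac{\delta h}{\delta\mu}\mu-\mu\frac{\delta h}{\delta\mu}D_\Gamma^{-1},$$ $$h(\mu)=\frac12\Bigl(\sum_i\Gamma_i^2\ln(1-\mu_i)-c\sum_{i<j}\Gamma_i\Gamma_j\ln(\mu_i+\mu_j-2\operatorname{Re}\mu_{ij})\Bigr),$$ on the open set where $\mu_i<1$ for all $i$ and $\mu_i+\mu_j-2\operatorname{Re}\mu_{ij}>0$ for all $i<j$. The relative dynamics takes place in the invariant set $\{\mu\in\mathfrak u(N):\operatorname{rank}\mu=1\}$. A relative equilibrium (a rigidly rotating configuration) corresponds to a fixed point, and its stability means Lyapunov stability of this fixed point for the relative dynamics (for initial conditions in this invariant set). *)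

theory Defs
  imports "HOL-Analysis.Analysis"
begin

type_synonym cmat4 = "complex^4^4"

definition conj_transpose :: "complex^'n^'m \<Rightarrow> complex^'m^'n" where
  "conj_transpose A = map_matrix cnj (transpose A)"

definition skew_hermitian :: "(complex^'n^'n) set" where
  "skew_hermitian = {A. conj_transpose A = - A}"

text \<open>The trace below is real for skew-Hermitian arguments, so \<^term>\<open>Re\<close> only adjusts the type.\<close>

definition u_inner :: "complex^'n^'n \<Rightarrow> complex^'n^'n \<Rightarrow> real" where
  "u_inner \<xi> \<eta> = Re (trace (conj_transpose \<xi> ** \<eta>)) / 2"

text \<open>The derivative is taken in skew-Hermitian directions only. The description is unique by
  nondegeneracy of \<^const>\<open>u_inner\<close>; it is meaningful where \<open>f\<close> restricted to
  the skew-Hermitian matrices is differentiable.\<close>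

definition func_deriv :: "(complex^'n^'n \<Rightarrow> real) \<Rightarrow> complex^'n^'n \<Rightarrow> complex^'n^'n" where
  "func_deriv f \<mu> = (THE \<xi>. \<xi> \<in> skew_hermitian \<and>
     (\<forall>\<nu>\<in>skew_hermitian. ((\<lambda>s. f (\<mu> + s *\<^sub>R \<nu>)) has_real_derivative u_inner \<nu> \<xi>) (at 0)))"

text \<open>\<open>ment \<mu> i j\<close> is the \<open>(i, j)\<close> entry of the Hermitian matrix \<open>M\<close> with \<open>\<mu> = \<i>M\<close>.\<close>

definition ment :: "cmat4 \<Rightarrow> 4 \<Rightarrow> 4 \<Rightarrow> complex" where
  "ment \<mu> i j = - \<i> * \<mu> $ i $ j"

definition sqdist :: "cmat4 \<Rightarrow> 4 \<Rightarrow> 4 \<Rightarrow> real" where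
  "sqdist \<mu> i j = Re (ment \<mu> i i) + Re (ment \<mu> j j) - 2 * Re (ment \<mu> i j)"

text \<open>The pairs \<open>i < j\<close> are listed explicitly because \<open>4 = 0\<close> in the index type \<open>4\<close>, so that its
  built-in order is not the intended one.\<close>

definition vortex_pairs :: "(4 \<times> 4) set" where
  "vortex_pairs = {(1,2), (1,3), (1,4), (2,3), (2,4), (3,4)}"

definition phase_domain :: "cmat4 set" where
  "phase_domain = {\<mu> \<in> skew_hermitian. (\<forall>i. Re (ment \<mu> i i) < 1) \<and>
     (\<forall>(i,j)\<in>vortex_pairs. sqdist \<mu> i j > 0)}"

definition hamiltonian :: "real \<Rightarrow> real^4 \<Rightarrow> cmat4 \<Rightarrow> real" where
  "hamiltonian c \<Gamma> \<mu> = ((\<Sum>i\<in>UNIV. (\<Gamma> $ i)\<^sup>2 * ln (1 - Re (ment \<mu> i i)))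
     - c * (\<Sum>(i,j)\<in>vortex_pairs. \<Gamma> $ i * \<Gamma> $ j * ln (sqdist \<mu> i j))) / 2"

definition D_mat :: "real^'n \<Rightarrow> complex^'n^'n" where
  "D_mat \<Gamma> = (\<chi> i j. if i = j then complex_of_real (\<Gamma> $ i) else 0)"

definition relative_field :: "real \<Rightarrow> real^4 \<Rightarrow> cmat4 \<Rightarrow> cmat4" where
  "relative_field c \<Gamma> \<mu> =
     matrix_inv (D_mat \<Gamma>) ** func_deriv (hamiltonian c \<Gamma>) \<mu> ** \<mu>
     - \<mu> ** func_deriv (hamiltonian c \<Gamma>) \<mu> ** matrix_inv (D_mat \<Gamma>)"

definition rank_one :: "cmat4 set" where
  "rank_one = {\<mu> \<in> skew_hermitian. rank \<mu> = 1}"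

definition ode_solution ::
  "('a::real_normed_vector \<Rightarrow> 'a) \<Rightarrow> 'a set \<Rightarrow> real set \<Rightarrow> (real \<Rightarrow> 'a) \<Rightarrow> bool" where
  "ode_solution X U I x \<longleftrightarrow>
     (\<forall>t\<in>I. x t \<in> U \<and> (x has_vector_derivative X (x t)) (at t within I))"

text \<open>Lyapunov stability of the fixed point \<open>p\<close> of \<open>X\<close> (a vector field on \<open>U\<close>) for initial
  conditions in \<open>S\<close>. Solutions that start close to \<open>p\<close> are required to exist for all forward time,
  and every forward solution, also one given only on a bounded time interval, has to stay close
  to \<open>p\<close>. That solutions remain in \<open>S\<close> is not assumed.\<close>

definition lyapunov_stable ::
  "('a::real_normed_vector \<Rightarrow> 'a) \<Rightarrow> 'a set \<Rightarrow> 'a set \<Rightarrow> 'a \<Rightarrow> bool" where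
  "lyapunov_stable X U S p \<longleftrightarrow>
     p \<in> U \<inter> S \<and> X p = 0 \<and>
     (\<forall>\<epsilon>>0. \<exists>\<delta>>0. \<forall>q\<in>U \<inter> S. dist q p < \<delta> \<longrightarrow>
        (\<exists>x. x 0 = q \<and> ode_solution X U {0..} x) \<and>
        (\<forall>x T. T > 0 \<and> x 0 = q \<and> ode_solution X U {0..<T} x \<longrightarrow>
           (\<forall>t\<in>{0..<T}. dist (x t) p < \<epsilon>)))"

definition triangle_with_center :: "real \<Rightarrow> cmat4" where
  "triangle_with_center r =
    (let a = complex_of_real (r\<^sup>2); w = a * exp (2 * of_real pi * \<i> / 3) in
     map_matrix (\<lambda>m. \<i> * m)
       (vector [vector [a,     cnj w, w,     0],
                vector [w,     a,     cnj w, 0],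
                vector [cnj w, w,     a,     0],
                vector [0,     0,     0,     0]]))"

end

theory Submission
  imports Defs
begin

text \<open>The flow conjugates \<open>\<mu>\<close> by unitary matrices, so it conserves \<open>tr M\<close>, the Hamiltonian, and the
  vanishing of all \<open>2 \<times> 2\<close> minors. With \<open>k = 1 / (1 - r\<^sup>2) + 2 c / r\<^sup>2\<close> the equilibrium is a critical
  point of \<open>2 h + k tr M\<close> on the rank-one matrices. Writing \<open>M = z z\<^sup>*\<close> and decomposing \<open>z\<close> into
  Fourier modes of the triangle, the Hessian becomes \<open>(12 c - 6 a\<^sup>2) A\<^sup>2\<close> plus two copies of a
  \<open>3 \<times> 3\<close> form with \<open>a = r\<^sup>2 / (1 - r\<^sup>2)\<close>, and all of them are positive definite when \<open>F\<^sub>6 < 0\<close>. A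
  strict local minimum of a conserved function is stable; trajectories trapped in a small ball
  exist for all forward time.\<close>

text \<open>The obstacle is that 2 h alone is not critical at the equilibrium: the configuration
  rotates, so the gradient of the energy does not annihilate the position vector \<open>z0\<close>
  but has it as an eigenvector, with eigenvalue - i k. This is where k comes from: it is the
  Lagrange multiplier for which adding k tr M cancels the eigenvalue. The set
  \<open>rank_one\<close> is not closed, since it accumulates at 0. Compactness therefore requires
  the larger closed set \<open>vanishing_minors\<close>, which near the equilibrium still consists
  of matrices with M = z z^*. The functional derivative is tested in skew-Hermitian directions only
  and says nothing off that subspace. All differential-equation arguments are therefore relative to
  a subspace, while the energy is extended to an open set of the full matrix space so that ordinary
  derivatives apply. The Hamiltonian contains only products of two circulations, so the common sign
  of the circulations enters through D_\<Gamma> alone and merely reverses time; conserved quantities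
  do not see it.\<close>

section \<open>Flows with a conserved Lyapunov function\<close>

text \<open>Picard iteration, made a contraction on all of \<open>[0, \<infinity>)\<close> at once by the weight \<open>exp (- 2 L t)\<close>.\<close>

lemma global_solution_exists:
  fixes Y :: "'a::euclidean_space \<Rightarrow> 'a"
  assumes L: "L > 0" and lip: "\<And>x y. dist (Y x) (Y y) \<le> L * dist x y"
    and B: "\<And>x. norm (Y x) \<le> B"
  obtains x where "x 0 = q"
    "\<And>t. t \<ge> 0 \<Longrightarrow> (x has_vector_derivative Y (x t)) (at t within {0..})"
proof -
  \<comment> \<open>The unknown is \<phi> t = exp (- 2 L t) (x t - q), which is bounded because Y
    is.\<close>
  define g where "g \<phi> s = Y (q + exp (2*L* s) *\<^sub>R \<phi> s)" for \<phi> :: "real \<Rightarrow> 'a" and s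
  define G where "G \<phi> t = integral {0..t} (g \<phi>)" for \<phi> t
  \<comment> \<open>Bounded continuous functions live on the whole line here; \<open>max t 0\<close>
    freezes the iterate at negative times.\<close>
  define F where "F \<phi> t = exp (-2*L* max t 0) *\<^sub>R G \<phi> (max t 0)" for \<phi> t
  have Bge: "B \<ge> 0" using B norm_ge_zero order_trans by blast
  have Ycont: "continuous_on UNIV Y"
    using L lip by (intro lipschitz_on_continuous_on[of L] lipschitz_onI) auto
  have gcont: "continuous_on S (g \<phi>)" if "continuous_on UNIV \<phi>" for \<phi> S
  proof -
    have "continuous_on S (\<lambda>s. q + exp (2*L* s) *\<^sub>R \<phi> s)"
      using that by (intro continuous_intros) (auto intro: continuous_on_subset)
    then show ?thesis unfolding g_def
      by (rule continuous_on_compose2[OF Ycont]) auto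
  qed
  have gint: "g \<phi> integrable_on {0..t}" if "continuous_on UNIV \<phi>" for \<phi> t
    by (intro integrable_continuous_real gcont that)
  have Gder: "(G \<phi> has_vector_derivative g \<phi> t) (at t within {0..})"
    if "continuous_on UNIV \<phi>" "t \<ge> 0" for \<phi> t
  proof -
    have "(G \<phi> has_vector_derivative g \<phi> t) (at t within {0..t+1})"
      unfolding G_def using that by (intro integral_has_vector_derivative gcont) auto
    moreover have "at t within {0..t+1} = at t within {0..}"
      by (rule at_within_nhd[of _ "{..<t+1}"]) auto
    ultimately show ?thesis by simp
  qed
  have Gcont: "continuous_on {0..} (G \<phi>)" if "continuous_on UNIV \<phi>" for \<phi>
    using Gder[OF that] has_vector_derivative_continuous
    by (fastforce simp: continuous_on_eq_continuous_within)
  have Fcont: "continuous_on UNIV (F \<phi>)" if "continuous_on UNIV \<phi>" for \<phi>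
    unfolding F_def
    by (intro continuous_intros continuous_on_compose2[OF Gcont[OF that]]) auto
  have Fbound: "norm (F \<phi> t) \<le> B / (2*L)" if "continuous_on UNIV \<phi>" for \<phi> t
  proof -
    define s where "s = max t 0"
    have s: "s \<ge> 0" by (simp add: s_def)
    have "norm (G \<phi> s) \<le> B * s"
      unfolding G_def using integral_bound[OF s gcont[OF that], of B] B by (simp add: g_def)
    also have "\<dots> \<le> B * (exp (2*L* s) / (2*L))"
    proof (rule mult_left_mono[OF _ Bge])
      have "2*L* s \<le> exp (2*L* s)" using exp_ge_add_one_self[of "2*L* s"] by linarith
      then show "s \<le> exp (2*L* s) / (2*L)" using L by (simp add: field_simps)
    qed
    finally have "exp (-2*L* s) * norm (G \<phi> s) \<le> exp (-2*L* s) * (B * (exp (2*L* s) / (2*L)))"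
      by (intro mult_left_mono) auto
    also have "\<dots> = B / (2*L)" by (simp add: exp_minus field_simps)
    finally show ?thesis by (simp add: F_def s_def)
  qed
  have contr: "dist (F \<phi> t) (F \<psi> t) \<le> 1/2 * d"
    if c: "continuous_on UNIV \<phi>" "continuous_on UNIV \<psi>"
      and d: "\<And>s. dist (\<phi> s) (\<psi> s) \<le> d" for \<phi> \<psi> t d
  proof -
    define s where "s = max t 0"
    have s: "s \<ge> 0" by (simp add: s_def)
    have d0: "d \<ge> 0" using d[of 0] zero_le_dist order_trans by blast
    \<comment> \<open>The rate 2 L in the weight, twice the Lipschitz constant, produces the
      contraction factor 1/2: the bound L exp (2 L u) d integrates to at most exp (2 L s) d /
      2.\<close>
    have "((\<lambda>u. L * exp (2*L*u) * d) has_integral (exp (2*L* s) / 2 * d - exp (2*L*0) / 2 * d)) {0..s}"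
      using L by (intro fundamental_theorem_of_calculus s)
        (auto intro!: derivative_eq_intros simp: has_real_derivative_iff_has_vector_derivative[symmetric])
    then have I: "(\<lambda>u. L * exp (2*L*u) * d) integrable_on {0..s}"
      "integral {0..s} (\<lambda>u. L * exp (2*L*u) * d) = exp (2*L* s) / 2 * d - d/2"
      by (auto simp: has_integral_iff)
    have "norm (G \<phi> s - G \<psi> s) = norm (integral {0..s} (\<lambda>u. g \<phi> u - g \<psi> u))"
      unfolding G_def by (subst integral_diff) (auto intro!: gint c)
    also have "\<dots> \<le> integral {0..s} (\<lambda>u. L * exp (2*L*u) * d)"
    proof (rule integral_norm_bound_integral)
      fix u assume "u \<in> {0..s}"
      have "norm (g \<phi> u - g \<psi> u) \<le> L * dist (q + exp (2*L*u) *\<^sub>R \<phi> u) (q + exp (2*L*u) *\<^sub>R \<psi> u)"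
        using lip[of "q + exp (2*L*u) *\<^sub>R \<phi> u" "q + exp (2*L*u) *\<^sub>R \<psi> u"]
        by (simp add: g_def dist_norm)
      also have "\<dots> = L * exp (2*L*u) * dist (\<phi> u) (\<psi> u)"
        by (simp add: dist_norm scaleR_diff_right[symmetric])
      also have "\<dots> \<le> L * exp (2*L*u) * d" using L by (intro mult_left_mono d) auto
      finally show "norm (g \<phi> u - g \<psi> u) \<le> L * exp (2*L*u) * d" .
    qed (auto intro!: integrable_diff gint c I)
    also have "\<dots> \<le> exp (2*L* s) / 2 * d" unfolding I(2) using d0 by simp
    finally have "exp (-2*L* s) * norm (G \<phi> s - G \<psi> s) \<le> exp (-2*L* s) * (exp (2*L* s) / 2 * d)"
      by (intro mult_left_mono) auto
    also have "\<dots> = 1/2 * d" by (simp add: exp_minus field_simps)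
    finally show ?thesis
      by (simp add: F_def s_def dist_norm scaleR_diff_right[symmetric])
  qed
  define T :: "(real \<Rightarrow>\<^sub>C 'a) \<Rightarrow> (real \<Rightarrow>\<^sub>C 'a)" where "T \<phi> = Bcontfun (F (apply_bcontfun \<phi>))" for \<phi>
  have cb: "continuous_on UNIV (apply_bcontfun \<phi>)" for \<phi> :: "real \<Rightarrow>\<^sub>C 'a" by simp
  have T: "apply_bcontfun (T \<phi>) = F (apply_bcontfun \<phi>)" for \<phi>
    unfolding T_def by (intro Bcontfun_inverse bcontfun_normI[of _ "B/(2*L)"] Fcont Fbound cb)
  have "\<exists>!\<phi>. T \<phi> = \<phi>"
    by (rule banach_fix_type[of "1/2"]) (auto intro!: dist_bound contr dist_bounded simp: T simp del: mult_1 divide_const_simps times_divide_eq_left)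
  then obtain \<phi> where \<phi>: "F (apply_bcontfun \<phi>) = apply_bcontfun \<phi>" using T by metis
  define x where "x t = q + G (apply_bcontfun \<phi>) t" for t
  have gx: "g (apply_bcontfun \<phi>) t = Y (x t)" if "t \<ge> 0" for t
  proof -
    have "apply_bcontfun \<phi> t = exp (-2*L*t) *\<^sub>R G (apply_bcontfun \<phi>) t"
      using fun_cong[OF \<phi>, of t] that by (simp add: F_def)
    then show ?thesis by (simp add: g_def x_def exp_minus)
  qed
  show ?thesis
  proof
    show "x 0 = q" by (simp add: x_def G_def)
    show "(x has_vector_derivative Y (x t)) (at t within {0..})" if "t \<ge> 0" for t
      unfolding x_def using Gder[OF cb that, of \<phi>] gx[OF that]
      by (auto intro!: derivative_eq_intros simp: x_def)
  qed
qed

text \<open>For the one time t in question, b is the component of \<open>x t - x 0\<close>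
  orthogonal to W. Pairing the whole curve with this fixed b gives a function with zero derivative,
  so b is orthogonal to \<open>x t - x 0\<close> and hence to itself.\<close>

lemma stays_in_subspace:
  fixes x :: "real \<Rightarrow> 'a::euclidean_space"
  assumes W: "subspace W" and q: "x 0 \<in> W"
    and der: "\<And>t. t \<ge> 0 \<Longrightarrow> (x has_vector_derivative v t) (at t within {0..})"
    and v: "\<And>t. t \<ge> 0 \<Longrightarrow> v t \<in> W" and t: "t \<ge> 0"
  shows "x t \<in> W"
proof -
  obtain a b where ab: "a \<in> span W" "\<And>w. w \<in> span W \<Longrightarrow> orthogonal b w" "x t - x 0 = a + b"
    using orthogonal_subspace_decomp_exists by metis
  have sW: "span W = W" using W by (simp add: span_eq_iff)
  have bW: "b \<bullet> w = 0" if "w \<in> W" for w using ab(2) that sW by (simp add: orthogonal_def)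
  have d: "((\<lambda>s. b \<bullet> x s) has_vector_derivative 0) (at s within {0..})" if "s \<in> {0..}" for s
  proof -
    have "((\<lambda>s. b \<bullet> x s) has_vector_derivative b \<bullet> v s) (at s within {0..})"
      using that by (intro bounded_linear.has_vector_derivative[OF bounded_linear_inner_right] der) auto
    then show ?thesis using bW v that by simp
  qed
  obtain k where "\<And>s. s \<in> {0..} \<Longrightarrow> b \<bullet> x s = k"
    using has_vector_derivative_zero_constant[of "{0..}" "\<lambda>s. b \<bullet> x s"] d by auto
  then have "b \<bullet> (x t - x 0) = 0" using t by (simp add: inner_diff_right)
  then have "b \<bullet> b = 0" using ab bW sW by (simp add: inner_add_right)
  then have "x t = a + x 0" using ab by (simp add: algebra_simps)
  then show ?thesis using ab(1) sW q W by (simp add: subspace_add)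
qed

text \<open>Composing X with the nearest-point projection onto the compact convex set K gives a
  bounded, globally Lipschitz field with values in W that agrees with X on K. Its global solution
  stays in W, but solves the original equation only while it is in the ball.\<close>

lemma solution_in_subspace_exists:
  fixes X :: "'a::euclidean_space \<Rightarrow> 'a"
  assumes W: "subspace W" and p: "p \<in> W" and \<rho>: "\<rho> > 0"
    and XW: "\<And>x. x \<in> cball p \<rho> \<inter> W \<Longrightarrow> X x \<in> W"
    and lip: "L-lipschitz_on (cball p \<rho> \<inter> W) X" and q: "q \<in> W"
  obtains x where "x 0 = q" "\<And>t. t \<ge> 0 \<Longrightarrow> x t \<in> W" "continuous_on {0..} x"
    "\<And>t. t \<ge> 0 \<Longrightarrow> x t \<in> cball p \<rho> \<Longrightarrow> (x has_vector_derivative X (x t)) (at t within {0..})"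
proof -
  define K where "K = cball p \<rho> \<inter> W"
  have K: "convex K" "closed K" "K \<noteq> {}" "compact K"
    using W p \<rho> closed_subspace[OF W] convex_Int[OF convex_cball subspace_imp_convex[OF W]]
    by (auto simp: K_def compact_Int_closed intro: exI[of _ p] simp flip: ex_in_conv)
  define Y where "Y x = X (closest_point K x)" for x
  have cpK: "closest_point K x \<in> K" for x by (rule closest_point_in_set) (use K in auto)
  have "compact (X ` K)"
    using lipschitz_on_continuous_on[OF lip] K by (intro compact_continuous_image) (auto simp: K_def)
  then obtain B where B: "\<And>y. y \<in> K \<Longrightarrow> norm (X y) \<le> B"
    by (meson bounded_iff compact_imp_bounded imageI)
  have L0: "L \<ge> 0" using lip lipschitz_on_nonneg by blast
  have Ylip: "dist (Y x) (Y y) \<le> (L + 1) * dist x y" for x y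
  proof -
    have "dist (Y x) (Y y) \<le> L * dist (closest_point K x) (closest_point K y)"
      unfolding Y_def using lipschitz_onD[OF lip] cpK by (simp add: K_def)
    also have "\<dots> \<le> (L + 1) * dist x y"
      using closest_point_lipschitz[OF K(1-3)] L0 by (intro mult_mono) auto
    finally show ?thesis .
  qed
  obtain x where x: "x 0 = q" "\<And>t. t \<ge> 0 \<Longrightarrow> (x has_vector_derivative Y (x t)) (at t within {0..})"
    using global_solution_exists[of "L+1" Y B q] Ylip L0 B cpK by (auto simp: Y_def)
  have xW: "x t \<in> W" if "t \<ge> 0" for t
    by (rule stays_in_subspace[OF W _ x(2) _ that]) (use x q XW cpK in \<open>auto simp: Y_def K_def\<close>)
  show ?thesis
  proof
    show "continuous_on {0..} x" using x(2) has_vector_derivative_continuous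
      by (fastforce simp: continuous_on_eq_continuous_within)
    show "(x has_vector_derivative X (x t)) (at t within {0..})" if "t \<ge> 0" "x t \<in> cball p \<rho>" for t
      using x(2)[of t] that xW closest_point_self[of "x t" K] by (simp add: Y_def K_def)
  qed (use x xW in auto)
qed

section \<open>Trapping by a conserved function\<close>

lemma ode_solution_continuous_on: "ode_solution X U I x \<Longrightarrow> continuous_on I x"
  using has_vector_derivative_continuous
  by (fastforce simp: ode_solution_def continuous_on_eq_continuous_within)

lemma ode_solution_subset: "ode_solution X U I x \<Longrightarrow> J \<subseteq> I \<Longrightarrow> ode_solution X U J x"
  by (auto simp: ode_solution_def intro: has_vector_derivative_within_subset)

lemma dist_crossing:
  fixes x :: "real \<Rightarrow> 'a::metric_space"
  assumes "continuous_on {0..t} x" "t \<ge> 0" "dist (x 0) p < \<rho>" "dist (x t) p \<ge> \<rho>"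
  obtains s where "0 \<le> s" "s \<le> t" "dist (x s) p = \<rho>"
  using IVT'[of "\<lambda>t. dist (x t) p" 0 \<rho> t] assms
  by (force intro: continuous_intros)

text \<open>On the compact part C of a small sphere inside W and S', V is at least some m > V p. A
  solution starting so close to p that V is below m keeps its value of V and cannot meet the sphere.
  The set S' stands in for S because C has to be closed.\<close>

lemma lyapunov_stable_if_conserved:
  fixes X :: "'a::euclidean_space \<Rightarrow> 'a" and V :: "'a \<Rightarrow> real"
  assumes W: "subspace W" "U \<subseteq> W" and p: "p \<in> U \<inter> S" "X p = 0"
    and S': "S \<subseteq> S'" "closed S'"
    and \<rho>0: "\<rho>0 > 0" "cball p \<rho>0 \<inter> W \<subseteq> U"
    and XW: "\<And>x. x \<in> U \<Longrightarrow> X x \<in> W"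
    and lip: "L-lipschitz_on (cball p \<rho>0 \<inter> W) X"
    and cons: "\<And>x b. b \<ge> 0 \<Longrightarrow> ode_solution X U {0..b} x \<Longrightarrow> x 0 \<in> S' \<Longrightarrow> x b \<in> S' \<and> V (x b) = V (x 0)"
    and Vcont: "continuous_on (cball p \<rho>0 \<inter> W) V"
    and min: "\<And>q. q \<in> cball p \<rho>0 \<inter> W \<inter> S' \<Longrightarrow> q \<noteq> p \<Longrightarrow> V q > V p"
  shows "lyapunov_stable X U S p"
  unfolding lyapunov_stable_def
proof (intro conjI allI impI)
  fix \<epsilon> :: real assume \<epsilon>: "\<epsilon> > 0"
  define \<rho> where "\<rho> = Min {\<epsilon>, \<rho>0}"
  have \<rho>: "\<rho> > 0" "\<rho> \<le> \<epsilon>" "\<rho> \<le> \<rho>0" using \<epsilon> \<rho>0 by (auto simp: \<rho>_def)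
  have clW: "closed W" using W closed_subspace by blast
  define C where "C = sphere p \<rho> \<inter> W \<inter> S'"
  have compC: "compact C" unfolding C_def using clW S' by (intro compact_Int_closed) auto
  have Csub: "C \<subseteq> cball p \<rho>0 \<inter> W \<inter> S'" using \<rho> by (auto simp: C_def)
  obtain m where m: "m > V p" "\<And>q. q \<in> C \<Longrightarrow> m \<le> V q"
  proof (cases "C = {}")
    case True
    then show ?thesis using that[of "V p + 1"] by auto
  next
    case False
    obtain z where z: "z \<in> C" "\<And>q. q \<in> C \<Longrightarrow> V z \<le> V q"
      using continuous_attains_inf[OF compC False, of V] continuous_on_subset[OF Vcont] Csub by blast
    have "z \<noteq> p" using z \<rho> by (auto simp: C_def)
    then show ?thesis using that[of "V z"] z min[of z] Csub by blast
  qed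
  have pK: "p \<in> cball p \<rho>0 \<inter> W" using p W \<rho>0 by auto
  obtain d where d: "d > 0" "\<And>q. q \<in> cball p \<rho>0 \<inter> W \<Longrightarrow> dist q p < d \<Longrightarrow> V q < m"
  proof -
    have "\<exists>d>0. \<forall>q\<in>cball p \<rho>0 \<inter> W. dist q p < d \<longrightarrow> dist (V q) (V p) < m - V p"
      using Vcont pK m unfolding continuous_on_iff by (meson diff_gt_0_iff_gt)
    then show ?thesis using that m by (force simp: dist_real_def)
  qed
  define \<delta> where "\<delta> = Min {d, \<rho>}"
  have \<delta>: "\<delta> > 0" "\<delta> \<le> d" "\<delta> \<le> \<rho>" using d \<rho> by (auto simp: \<delta>_def)
  have trap: "dist (x t) p \<noteq> \<rho>"
    if "x 0 \<in> U \<inter> S" "dist (x 0) p < \<delta>" "t \<ge> 0" "ode_solution X U {0..t} x" for x t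
  proof
    assume eq: "dist (x t) p = \<rho>"
    have "x t \<in> S'" "V (x t) = V (x 0)" using cons[OF that(3,4)] that(1) S' by auto
    moreover have "x t \<in> W" using that(3,4) W by (auto simp: ode_solution_def)
    ultimately have "m \<le> V (x 0)" using m(2)[of "x t"] eq by (auto simp: C_def dist_commute)
    moreover have "V (x 0) < m" using that W \<delta> \<rho> by (intro d) (auto simp: dist_commute)
    ultimately show False by simp
  qed
  show "\<exists>\<delta>>0. \<forall>q\<in>U \<inter> S. dist q p < \<delta> \<longrightarrow>
        (\<exists>x. x 0 = q \<and> ode_solution X U {0..} x) \<and>
        (\<forall>x T. T > 0 \<and> x 0 = q \<and> ode_solution X U {0..<T} x \<longrightarrow>
           (\<forall>t\<in>{0..<T}. dist (x t) p < \<epsilon>))"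
  proof (intro exI[of _ \<delta>] conjI ballI impI allI)
    fix q assume q: "q \<in> U \<inter> S" "dist q p < \<delta>"
    then have "q \<in> W" using W by auto
    obtain x where x: "x 0 = q" "\<And>t. t \<ge> 0 \<Longrightarrow> x t \<in> W" "continuous_on {0..} x"
      "\<And>t. t \<ge> 0 \<Longrightarrow> x t \<in> cball p \<rho>0 \<Longrightarrow> (x has_vector_derivative X (x t)) (at t within {0..})"
      using solution_in_subspace_exists[OF W(1) _ \<rho>0(1) _ lip \<open>q \<in> W\<close>] XW \<rho>0 pK by blast
    have xsol: "ode_solution X U {0..b} x" if "\<And>t. 0 \<le> t \<Longrightarrow> t \<le> b \<Longrightarrow> x t \<in> cball p \<rho>" for b
      unfolding ode_solution_def
    proof (intro ballI conjI)
      fix t assume t: "t \<in> {0..b}"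
      then have "x t \<in> cball p \<rho>0" using that[of t] \<rho> by auto
      then show "x t \<in> U" "(x has_vector_derivative X (x t)) (at t within {0..b})"
        using t x(2) \<rho>0 by (auto intro!: has_vector_derivative_within_subset[OF x(4)])
    qed
    have stay: "dist (x t) p < \<rho>" if t: "t \<ge> 0" for t
    proof (rule ccontr)
      assume far: "\<not> dist (x t) p < \<rho>"
      \<comment> \<open>The auxiliary curve x is known to solve the equation only inside the ball,
        so \<open>trap\<close> can be applied no later than the first time the sphere is reached.
        That time is the infimum of the closed set H.\<close>
      define H where "H = {s \<in> {0..}. dist (x s) p = \<rho>}"
      have x0: "dist (x 0) p < \<rho>" using x q \<delta> by auto
      have "continuous_on {0..t} x" by (rule continuous_on_subset[OF x(3)]) auto
      then obtain s where "0 \<le> s" "dist (x s) p = \<rho>"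
        using dist_crossing[of t x p \<rho>] far t x0 by (metis not_less)
      then have "H \<noteq> {}" by (auto simp: H_def)
      moreover have "closed H"
        unfolding H_def by (intro continuous_closed_preimage_constant continuous_intros x(3))
      moreover have "bdd_below H" by (auto simp: H_def intro!: bdd_belowI[of _ 0])
      ultimately have b: "Inf H \<in> H" "\<And>s. s \<in> H \<Longrightarrow> Inf H \<le> s"
        using closed_contains_Inf cInf_lower by metis+
      have "x s \<in> cball p \<rho>" if s: "0 \<le> s" "s \<le> Inf H" for s
      proof (rule ccontr)
        assume *: "x s \<notin> cball p \<rho>"
        then have "dist (x s) p \<ge> \<rho>" by (simp add: dist_commute)
        moreover have "continuous_on {0..s} x" by (rule continuous_on_subset[OF x(3)]) auto
        ultimately obtain s' where s': "0 \<le> s'" "s' \<le> s" "dist (x s') p = \<rho>"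
          using dist_crossing[of s x p \<rho>] s(1) x0 by blast
        then have "Inf H \<le> s'" using b(2) by (auto simp: H_def)
        then have "s' = s" using s s' by simp
        then show False using * s' by (simp add: dist_commute)
      qed
      then have "ode_solution X U {0..Inf H} x" by (rule xsol)
      then show False using trap[of x "Inf H"] b(1) x(1) q by (auto simp: H_def)
    qed
    show "\<exists>x. x 0 = q \<and> ode_solution X U {0..} x"
    proof (intro exI conjI)
      show "x 0 = q" by fact
      show "ode_solution X U {0..} x"
        unfolding ode_solution_def
      proof (intro ballI conjI)
        fix t :: real assume t: "t \<in> {0..}"
        then have "x t \<in> cball p \<rho>0" using stay[of t] \<rho> by (simp add: dist_commute)
        then show "x t \<in> U" "(x has_vector_derivative X (x t)) (at t within {0..})"
          using t x(2,4) \<rho>0 by auto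
      qed
    qed
  next
    fix q x T t assume q: "q \<in> U \<inter> S" "dist q p < \<delta>"
      and x: "T > 0 \<and> x 0 = q \<and> ode_solution X U {0..<T} x" and t: "t \<in> {0..<T}"
    have "dist (x t) p < \<rho>"
    proof (rule ccontr)
      assume far: "\<not> dist (x t) p < \<rho>"
      have "continuous_on {0..t} x"
        using x t by (intro continuous_on_subset[OF ode_solution_continuous_on[of X U "{0..<T}"]]) auto
      then obtain s where s: "0 \<le> s" "s \<le> t" "dist (x s) p = \<rho>"
        using dist_crossing[of t x p \<rho>] far t x q \<delta>
        by (metis atLeastLessThan_iff less_le_trans not_less)
      have "ode_solution X U {0..s} x"
        using s t by (intro ode_solution_subset[OF conjunct2[OF conjunct2[OF x]]]) auto
      then show False using trap[of x s] s x q by blast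
    qed
    then show "dist (x t) p < \<epsilon>" using \<rho> by simp
  qed (fact \<delta>(1))
qed (use p in auto)

section \<open>Commutators and rank-one matrices\<close>

lemma bounded_bilinear_matrix_mult:
  "bounded_bilinear ((**) :: complex^'n^'m \<Rightarrow> complex^'k^'n \<Rightarrow> complex^'k^'m)"
  unfolding bilinear_conv_bounded_bilinear[symmetric] bilinear_def
  by (auto intro!: linearI simp: matrix_matrix_mult_def vec_eq_iff sum.distrib algebra_simps
      scaleR_sum_right)

lemma inner_mult_complex_left: "(a * b) \<bullet> c = b \<bullet> (cnj a * c)" for a b c :: complex
  by (simp add: inner_complex_def algebra_simps)

lemma inner_mult_complex_right: "(a * b) \<bullet> c = a \<bullet> (c * cnj b)" for a b c :: complex
  by (simp add: inner_complex_def algebra_simps)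

lemma inner_matrix_mult_left:
  fixes A :: "complex^'n^'m" and B :: "complex^'k^'n"
  shows "(A ** B) \<bullet> C = B \<bullet> (conj_transpose A ** C)"
proof -
  have "(A ** B) \<bullet> C = (\<Sum>i\<in>UNIV. \<Sum>j\<in>UNIV. \<Sum>k\<in>UNIV. B$k$j \<bullet> (cnj (A$i$k) * C$i$j))"
    by (simp add: inner_vec_def matrix_matrix_mult_def inner_sum_left inner_mult_complex_left)
  also have "\<dots> = (\<Sum>i\<in>UNIV. \<Sum>k\<in>UNIV. \<Sum>j\<in>UNIV. B$k$j \<bullet> (cnj (A$i$k) * C$i$j))"
    by (intro sum.cong refl) (rule sum.swap)
  also have "\<dots> = (\<Sum>k\<in>UNIV. \<Sum>i\<in>UNIV. \<Sum>j\<in>UNIV. B$k$j \<bullet> (cnj (A$i$k) * C$i$j))"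
    by (rule sum.swap)
  also have "\<dots> = (\<Sum>k\<in>UNIV. \<Sum>j\<in>UNIV. \<Sum>i\<in>UNIV. B$k$j \<bullet> (cnj (A$i$k) * C$i$j))"
    by (intro sum.cong refl) (rule sum.swap)
  also have "\<dots> = B \<bullet> (conj_transpose A ** C)"
    by (simp add: inner_vec_def matrix_matrix_mult_def inner_sum_right conj_transpose_def
        transpose_def map_matrix_def)
  finally show ?thesis .
qed

lemma inner_matrix_mult_right:
  fixes A :: "complex^'n^'m" and B :: "complex^'k^'n"
  shows "(A ** B) \<bullet> C = A \<bullet> (C ** conj_transpose B)"
proof -
  have "(A ** B) \<bullet> C = (\<Sum>i\<in>UNIV. \<Sum>j\<in>UNIV. \<Sum>k\<in>UNIV. A$i$k \<bullet> (C$i$j * cnj (B$k$j)))"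
    by (simp add: inner_vec_def matrix_matrix_mult_def inner_sum_left inner_mult_complex_right)
  also have "\<dots> = (\<Sum>i\<in>UNIV. \<Sum>k\<in>UNIV. \<Sum>j\<in>UNIV. A$i$k \<bullet> (C$i$j * cnj (B$k$j)))"
    by (intro sum.cong refl) (rule sum.swap)
  also have "\<dots> = A \<bullet> (C ** conj_transpose B)"
    by (simp add: inner_vec_def matrix_matrix_mult_def inner_sum_right conj_transpose_def
        transpose_def map_matrix_def)
  finally show ?thesis .
qed

lemma u_inner_eq: "u_inner \<xi> \<eta> = (\<xi> \<bullet> \<eta>) / 2"
proof -
  have "Re (trace (conj_transpose \<xi> ** \<eta>)) = (\<Sum>i\<in>UNIV. \<Sum>k\<in>UNIV. \<xi>$k$i \<bullet> \<eta>$k$i)"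
    by (simp add: trace_def matrix_matrix_mult_def conj_transpose_def transpose_def
        map_matrix_def inner_complex_def)
  also have "\<dots> = \<xi> \<bullet> \<eta>" by (subst sum.swap) (simp add: inner_vec_def)
  finally show ?thesis by (simp add: u_inner_def)
qed

lemma skew_hermitian_iff: "A \<in> skew_hermitian \<longleftrightarrow> (\<forall>i j. cnj (A $ j $ i) = - A $ i $ j)"
  by (auto simp: skew_hermitian_def conj_transpose_def transpose_def map_matrix_def vec_eq_iff)

lemma skew_hermitianD: "A \<in> skew_hermitian \<Longrightarrow> conj_transpose A = - A"
  by (simp add: skew_hermitian_def)

lemma subspace_skew_hermitian: "subspace (skew_hermitian :: (complex^'n^'n) set)"
  by (auto simp: subspace_def skew_hermitian_iff)

definition commutator :: "complex^'n^'n \<Rightarrow> complex^'n^'n \<Rightarrow> complex^'n^'n" where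
  "commutator A B = A ** B - B ** A"

lemma skew_hermitian_commutator:
  assumes "A \<in> skew_hermitian" "B \<in> skew_hermitian"
  shows "commutator A B \<in> skew_hermitian"
proof -
  have "cnj (A $ a $ k * B $ k $ b) = B $ b $ k * A $ k $ a" for a b k
    using assms by (simp add: skew_hermitian_iff mult.commute)
  moreover have "cnj (B $ a $ k * A $ k $ b) = A $ b $ k * B $ k $ a" for a b k
    using assms by (simp add: skew_hermitian_iff mult.commute)
  ultimately show ?thesis
    unfolding skew_hermitian_iff commutator_def
    by (simp add: matrix_matrix_mult_def del: complex_cnj_mult)
qed

lemma matrix_mult_uminus_left: "(- A) ** B = - (A ** B)" for A :: "complex^'n^'m"
  by (rule bounded_bilinear.minus_left[OF bounded_bilinear_matrix_mult])

lemma matrix_mult_uminus_right: "A ** (- B) = - (A ** B)" for A :: "complex^'n^'m"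
  by (rule bounded_bilinear.minus_right[OF bounded_bilinear_matrix_mult])

text \<open>Multiplication by a skew-Hermitian matrix, from either side, is skew-adjoint for the
  real inner product, so both halves of the commutator are orthogonal to A.\<close>

lemma commutator_inner_self:
  assumes "\<xi> \<in> skew_hermitian"
  shows "commutator \<xi> A \<bullet> A = 0"
proof -
  have "(\<xi> ** A) \<bullet> A = 0"
    using inner_matrix_mult_left[of \<xi> A A] skew_hermitianD[OF assms]
    by (simp add: matrix_mult_uminus_left inner_commute)
  moreover have "(A ** \<xi>) \<bullet> A = 0"
    using inner_matrix_mult_right[of A \<xi> A] skew_hermitianD[OF assms]
    by (simp add: matrix_mult_uminus_right inner_commute)
  ultimately show ?thesis by (simp add: commutator_def inner_diff_left)
qed

text \<open>Moving \<xi> to the other side of the inner product leaves minus the inner product of A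
  with \<open>commutator \<xi> C\<close>. Taking C = i times the identity gives conservation of the
  trace; taking C = \<xi>, the gradient, gives conservation of the energy.\<close>

lemma commutator_inner_commuting:
  assumes "\<xi> \<in> skew_hermitian" "\<xi> ** C = C ** \<xi>"
  shows "commutator \<xi> A \<bullet> C = 0"
  using inner_matrix_mult_left[of \<xi> A C] inner_matrix_mult_right[of A \<xi> C]
    skew_hermitianD[OF assms(1)] assms(2)
  by (simp add: commutator_def inner_diff_left matrix_mult_uminus_left matrix_mult_uminus_right)

text \<open>On the skew-Hermitian matrices the minors are controlled by unitary invariants (see
  \<open>sum_norm_minors\<close>), so that the flow, which acts by conjugation, preserves their vanishing.\<close>

definition vanishing_minors :: "(complex^'n^'n) set" where
  "vanishing_minors = {\<mu>. \<forall>i j k l. \<mu>$i$j * \<mu>$k$l = \<mu>$i$l * \<mu>$k$j}"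

lemma closed_vanishing_minors: "closed (vanishing_minors :: (complex^'n^'n) set)"
  unfolding vanishing_minors_def
  by (intro closed_Collect_all closed_Collect_eq continuous_intros)

lemma rank_one_factor:
  assumes "rank (\<mu> :: complex^'n^'n) = 1"
  obtains u v where "\<And>i j. \<mu>$i$j = u i * v j"
proof -
  have d: "vec.dim (rows \<mu>) = 1" using assms by (simp add: row_rank_def_gen)
  obtain B where B: "B \<subseteq> rows \<mu>" "vec.independent B" "rows \<mu> \<subseteq> vec.span B" "card B = 1"
    using vec.basis_exists[of "rows \<mu>"] d by metis
  then obtain v where "B = {v}" by (auto simp: card_1_singleton_iff)
  then have "\<exists>k. \<mu>$i = k *s v" for i
    using B(3) by (auto simp: vec.span_singleton rows_def row_def)
  then obtain u where "\<And>i. \<mu>$i = u i *s v" by metis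
  then show ?thesis by (intro that[of u "\<lambda>j. v$j"]) simp
qed

lemma rank_one_subset_vanishing_minors: "rank_one \<subseteq> vanishing_minors"
proof
  fix \<mu> assume "\<mu> \<in> rank_one"
  then have "rank \<mu> = 1" by (simp add: rank_one_def)
  then obtain u v where "\<And>i j. \<mu>$i$j = u i * v j" by (rule rank_one_factor) blast
  then show "\<mu> \<in> vanishing_minors" by (simp add: vanishing_minors_def)
qed

text \<open>A Lagrange identity. Expanding each squared minor gives two terms that sum to the
  squared Frobenius norm squared, and a cross term built from the Gram matrix P = - \<mu> \<mu>. In
  terms of the eigenvalues i \<lambda> of \<mu>, the right-hand side is twice (sum of \<lambda>^2)^2
  minus the sum of \<lambda>^4, which vanishes when at most one \<lambda> is nonzero.\<close>

lemma sum_norm_minors: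
  fixes \<mu> :: "complex^'n^'n"
  assumes "\<mu> \<in> skew_hermitian"
  shows "(\<Sum>i\<in>UNIV. \<Sum>k\<in>UNIV. \<Sum>j\<in>UNIV. \<Sum>l\<in>UNIV. (norm (\<mu>$i$j * \<mu>$k$l - \<mu>$i$l * \<mu>$k$j))\<^sup>2)
    = 2 * ((\<mu> \<bullet> \<mu>)\<^sup>2 - (\<mu> ** \<mu>) \<bullet> (\<mu> ** \<mu>))"
proof -
  define P where "P i k = (\<Sum>j\<in>UNIV. \<mu>$i$j * cnj (\<mu>$k$j))" for i k
  have P: "P i k = - (\<mu> ** \<mu>)$i$k" for i k
  proof -
    have "cnj (\<mu>$k$j) = - \<mu>$j$k" for j using assms by (simp add: skew_hermitian_iff)
    then show ?thesis by (simp add: P_def matrix_matrix_mult_def sum_negf)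
  qed
  have Pc: "P k i = cnj (P i k)" for i k by (simp add: P_def mult.commute)
  have e: "(norm (a*d - b*c))\<^sup>2 = (norm a)\<^sup>2 * (norm d)\<^sup>2 + (norm b)\<^sup>2 * (norm c)\<^sup>2
      - 2 * Re ((a * cnj c) * (d * cnj b))" for a b c d :: complex
    unfolding cmod_power2 by (simp add: power2_eq_square algebra_simps)
  have n: "(\<Sum>i\<in>UNIV. \<Sum>j\<in>UNIV. (norm (\<mu>$i$j))\<^sup>2) = \<mu> \<bullet> \<mu>"
    by (simp add: inner_vec_def dot_square_norm)
  have s1: "(\<Sum>i\<in>UNIV. \<Sum>k\<in>UNIV. \<Sum>j\<in>UNIV. \<Sum>l\<in>UNIV. (norm (\<mu>$i$j))\<^sup>2 * (norm (\<mu>$k$l))\<^sup>2) = (\<mu> \<bullet> \<mu>)\<^sup>2"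
    unfolding n[symmetric] power2_eq_square[of "sum _ _"] by (simp add: sum_product)
  have s2: "(\<Sum>i\<in>UNIV. \<Sum>k\<in>UNIV. \<Sum>j\<in>UNIV. \<Sum>l\<in>UNIV. (norm (\<mu>$i$l))\<^sup>2 * (norm (\<mu>$k$j))\<^sup>2) = (\<mu> \<bullet> \<mu>)\<^sup>2"
    unfolding s1[symmetric] by (rule sum.cong[OF refl], rule sum.cong[OF refl], rule sum.swap)
  have s3: "(\<Sum>i\<in>UNIV. \<Sum>k\<in>UNIV. \<Sum>j\<in>UNIV. \<Sum>l\<in>UNIV.
      Re ((\<mu>$i$j * cnj (\<mu>$k$j)) * (\<mu>$k$l * cnj (\<mu>$i$l)))) = (\<mu> ** \<mu>) \<bullet> (\<mu> ** \<mu>)"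
  proof -
    have "(\<Sum>j\<in>UNIV. \<Sum>l\<in>UNIV. Re ((\<mu>$i$j * cnj (\<mu>$k$j)) * (\<mu>$k$l * cnj (\<mu>$i$l))))
        = (\<mu> ** \<mu>)$i$k \<bullet> (\<mu> ** \<mu>)$i$k" for i k
    proof -
      have "(\<Sum>j\<in>UNIV. \<Sum>l\<in>UNIV. Re ((\<mu>$i$j * cnj (\<mu>$k$j)) * (\<mu>$k$l * cnj (\<mu>$i$l))))
        = Re (P i k * P k i)"
        unfolding P_def sum_product Re_sum ..
      also have "\<dots> = (\<mu> ** \<mu>)$i$k \<bullet> (\<mu> ** \<mu>)$i$k"
        unfolding Pc[of k i] unfolding P by (simp add: inner_complex_def)
      finally show ?thesis .
    qed
    then show ?thesis by (simp add: inner_vec_def)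
  qed
  show ?thesis
    unfolding e sum.distrib sum_subtractf sum_distrib_left[of 2, symmetric] s1 s2 s3 by simp
qed

lemma vanishing_minors_iff:
  fixes \<mu> :: "complex^'n^'n"
  assumes "\<mu> \<in> skew_hermitian"
  shows "\<mu> \<in> vanishing_minors \<longleftrightarrow> (\<mu> ** \<mu>) \<bullet> (\<mu> ** \<mu>) = (\<mu> \<bullet> \<mu>)\<^sup>2"
proof -
  have "\<mu> \<in> vanishing_minors \<longleftrightarrow>
    (\<Sum>i\<in>UNIV. \<Sum>k\<in>UNIV. \<Sum>j\<in>UNIV. \<Sum>l\<in>UNIV. (norm (\<mu>$i$j * \<mu>$k$l - \<mu>$i$l * \<mu>$k$j))\<^sup>2) = 0"
    by (auto simp: sum_nonneg_eq_0_iff sum_nonneg vanishing_minors_def)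
  then show ?thesis using sum_norm_minors[OF assms] by auto
qed

section \<open>The relative vector field and its invariants\<close>

lemma vector_4 [simp]:
  "(vector [a,b,c,d] :: 'a::zero^4) $ 1 = a"
  "(vector [a,b,c,d] :: 'a::zero^4) $ 2 = b"
  "(vector [a,b,c,d] :: 'a::zero^4) $ 3 = c"
  "(vector [a,b,c,d] :: 'a::zero^4) $ 4 = d"
  unfolding vector_def by simp_all

lemma sum_vortex_pairs:
  "(\<Sum>q\<in>vortex_pairs. f q) = f (1,2) + (f (1,3) + (f (1,4) + (f (2,3) + (f (2,4) + f (3,4)))))"
  by (simp add: vortex_pairs_def)

text \<open>With respect to the real inner product these matrices represent the linear functionals
  \<open>\<mu>\<^sub>i\<close> and, on skew-Hermitian matrices, \<open>\<mu>\<^sub>i + \<mu>\<^sub>j - 2 Re \<mu>\<^sub>i\<^sub>j\<close>.\<close>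

definition diag_unit :: "4 \<Rightarrow> cmat4" where
  "diag_unit i = (\<chi> a b. if a = i \<and> b = i then \<i> else 0)"

definition pair_unit :: "4 \<times> 4 \<Rightarrow> cmat4" where
  "pair_unit q = (\<chi> a b. if (a = fst q \<or> a = snd q) \<and> (b = fst q \<or> b = snd q)
     then (if a = b then \<i> else -\<i>) else 0)"

lemma inner_diag_unit: "\<mu> \<bullet> diag_unit i = Re (ment \<mu> i i)"
  using exhaust_4[of i]
  by (auto simp: inner_vec_def sum_4 diag_unit_def ment_def inner_complex_def)

lemma inner_pair_unit:
  assumes "\<mu> \<in> skew_hermitian" "q \<in> vortex_pairs"
  shows "\<mu> \<bullet> pair_unit q = sqdist \<mu> (fst q) (snd q)"
proof -
  have "Im (\<mu>$j$i) = Im (\<mu>$i$j)" for i j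
    using assms(1) by (metis skew_hermitian_iff complex_cnj_cnj complex.sel(2) cnj.simps(2) minus_equation_iff uminus_complex.simps(2))
  then show ?thesis
    using assms(2) unfolding vortex_pairs_def
    by (auto simp: inner_vec_def sum_4 pair_unit_def sqdist_def ment_def inner_complex_def)
qed

lemma diag_unit_skew: "diag_unit i \<in> skew_hermitian"
  by (auto simp: skew_hermitian_iff diag_unit_def)

lemma pair_unit_skew: "pair_unit q \<in> skew_hermitian"
  by (auto simp: skew_hermitian_iff pair_unit_def)

text \<open>Unlike \<open>phase_domain\<close>, this set is open in the full matrix space, so
  two-sided derivatives and neighbourhoods need no restriction to a subspace.\<close>

definition positive_domain :: "cmat4 set" where
  "positive_domain = {\<mu>. (\<forall>i. \<mu> \<bullet> diag_unit i < 1) \<and> (\<forall>q\<in>vortex_pairs. \<mu> \<bullet> pair_unit q > 0)}"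

lemma phase_domain_eq: "phase_domain = positive_domain \<inter> skew_hermitian"
  unfolding phase_domain_def positive_domain_def
  by (auto simp: inner_diag_unit inner_pair_unit split: prod.splits)

lemma open_positive_domain: "open positive_domain"
proof -
  have "finite vortex_pairs" by (simp add: vortex_pairs_def)
  then have "open (\<Inter>q\<in>vortex_pairs. {\<mu>. \<mu> \<bullet> pair_unit q > 0})"
    by (intro open_INT ballI open_Collect_less continuous_intros)
  moreover have "open (\<Inter>i\<in>UNIV. {\<mu>. \<mu> \<bullet> diag_unit i < 1})"
    by (intro open_INT ballI open_Collect_less continuous_intros) auto
  ultimately have "open ((\<Inter>i\<in>UNIV. {\<mu>. \<mu> \<bullet> diag_unit i < 1})
      \<inter> (\<Inter>q\<in>vortex_pairs. {\<mu>. \<mu> \<bullet> pair_unit q > 0}))"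
    by (intro open_Int)
  moreover have "positive_domain = (\<Inter>i\<in>UNIV. {\<mu>. \<mu> \<bullet> diag_unit i < 1})
      \<inter> (\<Inter>q\<in>vortex_pairs. {\<mu>. \<mu> \<bullet> pair_unit q > 0})"
    by (auto simp: positive_domain_def)
  ultimately show ?thesis by simp
qed

text \<open>For circulations all 1 or all -1 this is 2 h on skew-Hermitian matrices. Written with
  linear functionals, it extends h off that subspace and is differentiable in every
  direction.\<close>

definition log_energy :: "real \<Rightarrow> cmat4 \<Rightarrow> real" where
  "log_energy c \<mu> = (\<Sum>i\<in>UNIV. ln (1 - \<mu> \<bullet> diag_unit i))
     - c * (\<Sum>q\<in>vortex_pairs. ln (\<mu> \<bullet> pair_unit q))"

definition energy_grad :: "real \<Rightarrow> cmat4 \<Rightarrow> cmat4" where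
  "energy_grad c \<mu> = - (\<Sum>i\<in>UNIV. inverse (1 - \<mu> \<bullet> diag_unit i) *\<^sub>R diag_unit i)
     - c *\<^sub>R (\<Sum>q\<in>vortex_pairs. inverse (\<mu> \<bullet> pair_unit q) *\<^sub>R pair_unit q)"

lemma energy_grad_skew: "energy_grad c \<mu> \<in> skew_hermitian"
  unfolding energy_grad_def using subspace_skew_hermitian
  by (intro subspace_diff subspace_neg subspace_sum subspace_scale diag_unit_skew pair_unit_skew)

lemma log_energy_derivative:
  assumes "\<mu> \<in> positive_domain"
  shows "(log_energy c has_derivative (\<lambda>\<nu>. \<nu> \<bullet> energy_grad c \<mu>)) (at \<mu>)"
proof -
  have d: "((\<lambda>\<mu>. ln (1 - \<mu> \<bullet> diag_unit i)) has_derivative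
      (\<lambda>\<nu>. - (inverse (1 - \<mu> \<bullet> diag_unit i) * (\<nu> \<bullet> diag_unit i)))) (at \<mu>)" for i
    using assms by (auto simp: positive_domain_def intro!: derivative_eq_intros)
  have e: "((\<lambda>\<mu>. ln (\<mu> \<bullet> pair_unit q)) has_derivative
      (\<lambda>\<nu>. inverse (\<mu> \<bullet> pair_unit q) * (\<nu> \<bullet> pair_unit q))) (at \<mu>)" if "q \<in> vortex_pairs" for q
    using assms that by (auto simp: positive_domain_def intro!: derivative_eq_intros)
  have "(log_energy c has_derivative
    (\<lambda>\<nu>. (\<Sum>i\<in>UNIV. - (inverse (1 - \<mu> \<bullet> diag_unit i) * (\<nu> \<bullet> diag_unit i)))
     - c * (\<Sum>q\<in>vortex_pairs. inverse (\<mu> \<bullet> pair_unit q) * (\<nu> \<bullet> pair_unit q)))) (at \<mu>)"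
    unfolding log_energy_def[abs_def]
    by (intro has_derivative_diff has_derivative_sum has_derivative_mult_right d e)
  moreover have "(\<lambda>\<nu>. (\<Sum>i\<in>UNIV. - (inverse (1 - \<mu> \<bullet> diag_unit i) * (\<nu> \<bullet> diag_unit i)))
     - c * (\<Sum>q\<in>vortex_pairs. inverse (\<mu> \<bullet> pair_unit q) * (\<nu> \<bullet> pair_unit q)))
    = (\<lambda>\<nu>. \<nu> \<bullet> energy_grad c \<mu>)"
    by (simp add: energy_grad_def inner_diff_right inner_sum_right sum_negf)
  ultimately show ?thesis by simp
qed

section \<open>The Lie-Poisson equation as a commutator equation\<close>

lemma hamiltonian_eq:
  assumes \<Gamma>: "(\<forall>i. \<Gamma> $ i = 1) \<or> (\<forall>i. \<Gamma> $ i = -1)" and "\<mu> \<in> skew_hermitian"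
  shows "hamiltonian c \<Gamma> \<mu> = log_energy c \<mu> / 2"
proof -
  have "(\<Gamma> $ i)\<^sup>2 = 1" "\<Gamma> $ i * \<Gamma> $ j = 1" for i j using \<Gamma> by auto
  moreover have "(\<Sum>q\<in>vortex_pairs. ln (\<mu> \<bullet> pair_unit q)) = (\<Sum>(i,j)\<in>vortex_pairs. ln (sqdist \<mu> i j))"
    using assms(2) by (intro sum.cong refl) (auto simp: inner_pair_unit)
  ultimately show ?thesis by (simp add: hamiltonian_def log_energy_def inner_diag_unit)
qed

lemma func_deriv_eq:
  fixes f :: "complex^'n^'n \<Rightarrow> real"
  assumes \<xi>: "\<xi> \<in> skew_hermitian"
    and d: "\<And>\<nu>. \<nu> \<in> skew_hermitian \<Longrightarrow>
      ((\<lambda>s. f (\<mu> + s *\<^sub>R \<nu>)) has_real_derivative u_inner \<nu> \<xi>) (at 0)"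
  shows "func_deriv f \<mu> = \<xi>"
  unfolding func_deriv_def
proof (rule the_equality)
  fix \<eta> assume \<eta>: "\<eta> \<in> skew_hermitian \<and> (\<forall>\<nu>\<in>skew_hermitian.
    ((\<lambda>s. f (\<mu> + s *\<^sub>R \<nu>)) has_real_derivative u_inner \<nu> \<eta>) (at 0))"
  then have "\<eta> - \<xi> \<in> skew_hermitian" using \<xi> by (simp add: subspace_diff[OF subspace_skew_hermitian])
  then have "u_inner (\<eta> - \<xi>) \<eta> = u_inner (\<eta> - \<xi>) \<xi>" using d \<eta> DERIV_unique by blast
  then have "(\<eta> - \<xi>) \<bullet> (\<eta> - \<xi>) = 0" by (simp add: u_inner_eq inner_diff_right)
  then show "\<eta> = \<xi>" by simp
qed (use assms in blast)

text \<open>The factor 1/2 appears twice and cancels: h is half of \<open>log_energy\<close>, and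
  \<open>u_inner\<close> is half of the real inner product. So the ordinary gradient of
  \<open>log_energy\<close> is the functional derivative of h.\<close>

lemma func_deriv_hamiltonian:
  assumes \<Gamma>: "(\<forall>i. \<Gamma> $ i = 1) \<or> (\<forall>i. \<Gamma> $ i = -1)" and \<mu>: "\<mu> \<in> phase_domain"
  shows "func_deriv (hamiltonian c \<Gamma>) \<mu> = energy_grad c \<mu>"
proof (rule func_deriv_eq[OF energy_grad_skew])
  fix \<nu> :: cmat4 assume \<nu>: "\<nu> \<in> skew_hermitian"
  have \<mu>': "\<mu> \<in> positive_domain" "\<mu> \<in> skew_hermitian" using \<mu> by (auto simp: phase_domain_eq)
  have "((\<lambda>s. log_energy c (\<mu> + s *\<^sub>R \<nu>)) has_derivative (\<lambda>s. (s *\<^sub>R \<nu>) \<bullet> energy_grad c \<mu>)) (at 0)"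
    by (rule has_derivative_compose[of "\<lambda>s. \<mu> + s *\<^sub>R \<nu>" "\<lambda>s. s *\<^sub>R \<nu>"])
      (use log_energy_derivative[OF \<mu>'(1)] in \<open>auto intro!: derivative_eq_intros\<close>)
  then have "((\<lambda>s. log_energy c (\<mu> + s *\<^sub>R \<nu>) / 2) has_real_derivative (\<nu> \<bullet> energy_grad c \<mu>) / 2) (at 0)"
    by (intro DERIV_cdivide) (simp add: has_field_derivative_def mult_commute_abs)
  moreover have "hamiltonian c \<Gamma> (\<mu> + s *\<^sub>R \<nu>) = log_energy c (\<mu> + s *\<^sub>R \<nu>) / 2" for s
    using \<mu>' \<nu> subspace_skew_hermitian
    by (intro hamiltonian_eq[OF \<Gamma>] subspace_add subspace_scale)
  ultimately show "((\<lambda>s. hamiltonian c \<Gamma> (\<mu> + s *\<^sub>R \<nu>)) has_real_derivative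
      u_inner \<nu> (energy_grad c \<mu>)) (at 0)"
    by (simp only: u_inner_eq)
qed

lemma matrix_inv_scaleR_mat:
  assumes "\<sigma> \<noteq> 0"
  shows "matrix_inv (\<sigma> *\<^sub>R mat 1 :: complex^'n^'n) = inverse \<sigma> *\<^sub>R mat 1"
proof -
  let ?D = "\<sigma> *\<^sub>R mat 1 :: complex^'n^'n"
  interpret bounded_bilinear "(**) :: complex^'n^'n \<Rightarrow> complex^'n^'n \<Rightarrow> complex^'n^'n"
    by (rule bounded_bilinear_matrix_mult)
  have "?D ** (inverse \<sigma> *\<^sub>R mat 1) = mat 1" "(inverse \<sigma> *\<^sub>R mat 1) ** ?D = mat 1"
    using assms by (simp_all add: scaleR_left scaleR_right)
  then have "\<exists>B. ?D ** B = mat 1 \<and> B ** ?D = mat 1" by blast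
  then have "?D ** matrix_inv ?D = mat 1 \<and> matrix_inv ?D ** ?D = mat 1"
    unfolding matrix_inv_def by (rule someI_ex)
  then have "\<sigma> *\<^sub>R matrix_inv ?D = mat 1" by (simp add: scaleR_left)
  then have "inverse \<sigma> *\<^sub>R (\<sigma> *\<^sub>R matrix_inv ?D) = inverse \<sigma> *\<^sub>R mat 1" by simp
  then show ?thesis using assms by simp
qed

text \<open>D_\<Gamma> is the scalar \<sigma> and equals its own inverse, so it commutes with
  everything and leaves a commutator.\<close>

lemma relative_field_eq:
  assumes \<Gamma>: "\<sigma> = 1 \<or> \<sigma> = -1" "\<And>i. \<Gamma> $ i = \<sigma>" and \<mu>: "\<mu> \<in> phase_domain"
  shows "relative_field c \<Gamma> \<mu> = \<sigma> *\<^sub>R commutator (energy_grad c \<mu>) \<mu>"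
proof -
  interpret bounded_bilinear "(**) :: cmat4 \<Rightarrow> cmat4 \<Rightarrow> cmat4"
    by (rule bounded_bilinear_matrix_mult)
  have D: "D_mat \<Gamma> = \<sigma> *\<^sub>R mat 1"
    by (simp add: D_mat_def mat_def vec_eq_iff of_real_def \<Gamma>(2))
  have i: "matrix_inv (D_mat \<Gamma>) = \<sigma> *\<^sub>R mat 1"
    unfolding D using \<Gamma>(1) by (subst matrix_inv_scaleR_mat) auto
  have f: "func_deriv (hamiltonian c \<Gamma>) \<mu> = energy_grad c \<mu>"
    by (rule func_deriv_hamiltonian) (use \<Gamma> \<mu> in auto)
  show ?thesis
    by (simp add: relative_field_def i f commutator_def scaleR_left scaleR_right scaleR_diff_right)
qed

section \<open>Conserved quantities along solutions\<close>

definition lyapunov_fun :: "real \<Rightarrow> real \<Rightarrow> cmat4 \<Rightarrow> real" where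
  "lyapunov_fun c k \<mu> = log_energy c \<mu> + k * (\<Sum>i\<in>UNIV. \<mu> \<bullet> diag_unit i)"

lemma sum_diag_unit: "(\<Sum>i\<in>UNIV. \<mu> \<bullet> diag_unit i) = \<mu> \<bullet> (\<chi> a b. if a = b then \<i> else 0)"
  by (simp add: sum_4 inner_vec_def diag_unit_def)

context
  fixes c \<sigma> :: real and \<Gamma> x b
  assumes \<Gamma>: "\<sigma> = 1 \<or> \<sigma> = -1" "\<And>i. \<Gamma> $ i = \<sigma>"
    and sol: "ode_solution (relative_field c \<Gamma>) phase_domain {0..b} x" and b: "b \<ge> 0"
begin

lemma solution_has_derivative:
  assumes "t \<in> {0..b}"
  shows "(x has_derivative (\<lambda>s. (s * \<sigma>) *\<^sub>R commutator (energy_grad c (x t)) (x t))) (at t within {0..b})"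
proof -
  have "x t \<in> phase_domain"
    "(x has_vector_derivative relative_field c \<Gamma> (x t)) (at t within {0..b})"
    using sol assms by (auto simp: ode_solution_def)
  then show ?thesis
    by (simp add: has_vector_derivative_def relative_field_eq[OF \<Gamma>])
qed

lemma conserved:
  fixes F :: "cmat4 \<Rightarrow> real"
  assumes "\<And>t. t \<in> {0..b} \<Longrightarrow> \<exists>F'. (F has_derivative F') (at (x t)) \<and>
    F' (commutator (energy_grad c (x t)) (x t)) = 0"
  shows "F (x b) = F (x 0)"
proof -
  have "((\<lambda>t. F (x t)) has_derivative (\<lambda>s. 0)) (at t within {0..b})" if t: "t \<in> {0..b}" for t
  proof -
    obtain F' where F': "(F has_derivative F') (at (x t))"
      "F' (commutator (energy_grad c (x t)) (x t)) = 0"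
      using assms[OF t] by blast
    have "((\<lambda>t. F (x t)) has_derivative
        (\<lambda>s. F' ((s * \<sigma>) *\<^sub>R commutator (energy_grad c (x t)) (x t)))) (at t within {0..b})"
      by (rule has_derivative_compose[OF solution_has_derivative[OF t] F'(1)])
    then show ?thesis
      by (simp add: linear_cmul[OF has_derivative_linear[OF F'(1)]] F'(2))
  qed
  then obtain k where "\<And>t. t \<in> {0..b} \<Longrightarrow> F (x t) = k"
    using has_derivative_zero_constant[of "{0..b}" "\<lambda>t. F (x t)"] by auto
  then show ?thesis using b by simp
qed

lemma lyapunov_fun_conserved: "lyapunov_fun c k (x b) = lyapunov_fun c k (x 0)"
proof (rule conserved, intro exI conjI)
  fix t assume "t \<in> {0..b}"
  then have pos: "x t \<in> positive_domain" using sol by (auto simp: ode_solution_def phase_domain_eq)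
  let ?J = "(\<chi> a b. if a = b then \<i> else 0) :: cmat4"
  show "(lyapunov_fun c k has_derivative (\<lambda>\<nu>. \<nu> \<bullet> energy_grad c (x t) + k * (\<nu> \<bullet> ?J))) (at (x t))"
    unfolding lyapunov_fun_def[abs_def] sum_diag_unit
    by (intro has_derivative_add log_energy_derivative[OF pos] has_derivative_mult_right
        has_derivative_inner_left has_derivative_ident)
  have "energy_grad c (x t) ** ?J = ?J ** energy_grad c (x t)"
    by (simp add: matrix_matrix_mult_def vec_eq_iff if_distrib if_distribR cong: if_cong)
  then have "commutator (energy_grad c (x t)) (x t) \<bullet> ?J = 0"
    by (rule commutator_inner_commuting[OF energy_grad_skew])
  moreover have "commutator (energy_grad c (x t)) (x t) \<bullet> energy_grad c (x t) = 0"
    by (rule commutator_inner_commuting[OF energy_grad_skew refl])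
  ultimately show "commutator (energy_grad c (x t)) (x t) \<bullet> energy_grad c (x t)
     + k * (commutator (energy_grad c (x t)) (x t) \<bullet> ?J) = 0" by simp
qed

text \<open>By \<open>vanishing_minors_iff\<close> it is enough that the norms of \<mu> and of \<mu>
  \<mu> are constant along the solution.\<close>

lemma vanishing_minors_conserved:
  assumes "x 0 \<in> vanishing_minors"
  shows "x b \<in> vanishing_minors"
proof -
  have skew: "x t \<in> skew_hermitian" if "t \<in> {0..b}" for t
    using sol that by (auto simp: ode_solution_def phase_domain_eq)
  have "x b \<bullet> x b = x 0 \<bullet> x 0"
  proof (rule conserved, intro exI conjI)
    fix t
    show "((\<lambda>\<mu>. \<mu> \<bullet> \<mu>) has_derivative (\<lambda>\<nu>. x t \<bullet> \<nu> + \<nu> \<bullet> x t)) (at (x t))"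
      by (intro has_derivative_inner has_derivative_ident)
    show "x t \<bullet> commutator (energy_grad c (x t)) (x t)
      + commutator (energy_grad c (x t)) (x t) \<bullet> x t = 0"
      using commutator_inner_self[OF energy_grad_skew, of c "x t" "x t"]
      by (simp add: inner_commute)
  qed
  moreover have "(x b ** x b) \<bullet> (x b ** x b) = (x 0 ** x 0) \<bullet> (x 0 ** x 0)"
  proof (rule conserved, intro exI conjI)
    fix t
    let ?\<xi> = "energy_grad c (x t)"
    have D: "((\<lambda>\<mu>. \<mu> ** \<mu>) has_derivative (\<lambda>\<nu>. x t ** \<nu> + \<nu> ** x t)) (at (x t))"
      by (intro bounded_bilinear.FDERIV[OF bounded_bilinear_matrix_mult] has_derivative_ident)
    show "((\<lambda>\<mu>. (\<mu> ** \<mu>) \<bullet> (\<mu> ** \<mu>)) has_derivative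
        (\<lambda>\<nu>. (x t ** x t) \<bullet> (x t ** \<nu> + \<nu> ** x t) + (x t ** \<nu> + \<nu> ** x t) \<bullet> (x t ** x t))) (at (x t))"
      by (intro has_derivative_inner D)
    \<comment> \<open>The commutator with \<xi> is a derivation, so the square of the solution also
      moves by a commutator with \<xi>.\<close>
    have "x t ** commutator ?\<xi> (x t) + commutator ?\<xi> (x t) ** x t = commutator ?\<xi> (x t ** x t)"
      by (simp add: commutator_def matrix_mul_assoc
          bounded_bilinear.diff_left[OF bounded_bilinear_matrix_mult]
          bounded_bilinear.diff_right[OF bounded_bilinear_matrix_mult])
    then show "(x t ** x t) \<bullet> (x t ** commutator ?\<xi> (x t) + commutator ?\<xi> (x t) ** x t)
      + (x t ** commutator ?\<xi> (x t) + commutator ?\<xi> (x t) ** x t) \<bullet> (x t ** x t) = 0"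
      using commutator_inner_self[OF energy_grad_skew, of c "x t" "x t ** x t"]
      by (simp add: inner_commute)
  qed
  ultimately show ?thesis
    using assms skew[of 0] skew[of b] b vanishing_minors_iff by fastforce
qed

end

section \<open>Lipschitz continuity of the vector field on compact sets\<close>

lemma lipschitz_on_bounded_bilinear:
  assumes "bounded_bilinear h" and K: "compact K"
    and f: "\<exists>L. L-lipschitz_on K f" and g: "\<exists>L. L-lipschitz_on K g"
  shows "\<exists>L. L-lipschitz_on K (\<lambda>x. h (f x) (g x))"
proof -
  interpret bounded_bilinear h by fact
  obtain L M where L: "L-lipschitz_on K f" and M: "M-lipschitz_on K g" using f g by blast
  have "compact (f ` K)" "compact (g ` K)"
    using lipschitz_on_continuous_on L M by (auto intro!: compact_continuous_image K)
  then obtain F G where F: "\<And>x. x \<in> K \<Longrightarrow> norm (f x) \<le> F" and G: "\<And>x. x \<in> K \<Longrightarrow> norm (g x) \<le> G"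
    by (metis compact_imp_bounded bounded_iff imageI)
  obtain B where B: "B > 0" "\<And>a b. norm (h a b) \<le> norm a * norm b * B" using pos_bounded by blast
  show ?thesis
  proof (cases "K = {}")
    case False
    then have F0: "F \<ge> 0" and G0: "G \<ge> 0" using F G norm_ge_zero order_trans by blast+
    have L0: "L \<ge> 0" "M \<ge> 0" using L M lipschitz_on_nonneg by auto
    have "((L * G + F * M) * B)-lipschitz_on K (\<lambda>x. h (f x) (g x))"
    proof (rule lipschitz_onI)
      fix x y assume xy: "x \<in> K" "y \<in> K"
      have "h (f x) (g x) - h (f y) (g y) = h (f x - f y) (g x) + h (f y) (g x - g y)"
        by (simp add: diff_left diff_right)
      then have "norm (h (f x) (g x) - h (f y) (g y))
          \<le> norm (f x - f y) * norm (g x) * B + norm (f y) * norm (g x - g y) * B"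
        by (metis B(2) add_mono norm_triangle_le)
      also have "\<dots> \<le> (L * dist x y) * G * B + F * (M * dist x y) * B"
        using lipschitz_onD[OF L xy] lipschitz_onD[OF M xy] F G xy B F0 G0 L0
        by (intro add_mono mult_right_mono mult_mono) (auto simp: dist_norm)
      finally show "dist (h (f x) (g x)) (h (f y) (g y)) \<le> (L * G + F * M) * B * dist x y"
        by (simp add: dist_norm algebra_simps)
    qed (use F0 G0 L0 B in auto)
    then show ?thesis by blast
  qed (auto intro: exI[of _ 0])
qed

lemma lipschitz_on_inverse:
  fixes f :: "'a::metric_space \<Rightarrow> real"
  assumes K: "compact K" and f: "\<exists>L. L-lipschitz_on K f" and pos: "\<And>x. x \<in> K \<Longrightarrow> f x > 0"
  shows "\<exists>L. L-lipschitz_on K (\<lambda>x. inverse (f x))"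
proof (cases "K = {}")
  case False
  obtain L where L: "L-lipschitz_on K f" using f by blast
  obtain z where z: "z \<in> K" "\<And>x. x \<in> K \<Longrightarrow> f z \<le> f x"
    using continuous_attains_inf[OF K False lipschitz_on_continuous_on[OF L]] by blast
  define m where "m = f z"
  have m: "m > 0" "\<And>x. x \<in> K \<Longrightarrow> m \<le> f x" using z pos by (auto simp: m_def)
  have L0: "L \<ge> 0" using L lipschitz_on_nonneg by auto
  have "(L * inverse (m * m))-lipschitz_on K (\<lambda>x. inverse (f x))"
  proof (rule lipschitz_onI)
    fix x y assume xy: "x \<in> K" "y \<in> K"
    have p: "f x > 0" "f y > 0" using xy pos by auto
    then have "dist (inverse (f x)) (inverse (f y)) = dist (f x) (f y) * inverse (f x * f y)"
      by (simp add: dist_real_def inverse_diff_inverse abs_mult abs_minus_commute)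
    also have "\<dots> \<le> (L * dist x y) * inverse (m * m)"
      using lipschitz_onD[OF L xy] m p xy L0
      by (intro mult_mono le_imp_inverse_le) auto
    finally show "dist (inverse (f x)) (inverse (f y)) \<le> L * inverse (m * m) * dist x y"
      by (simp add: mult_ac)
  qed (use L0 m in auto)
  then show ?thesis by blast
qed (auto intro: exI[of _ 0])

lemma ex_lipschitz_on_add:
  fixes f g :: "'a::metric_space \<Rightarrow> 'b::real_normed_vector"
  shows "\<exists>L. L-lipschitz_on K f \<Longrightarrow> \<exists>L. L-lipschitz_on K g \<Longrightarrow> \<exists>L. L-lipschitz_on K (\<lambda>x. f x + g x)"
  by (blast intro: lipschitz_on_add)

lemma ex_lipschitz_on_diff:
  fixes f g :: "'a::metric_space \<Rightarrow> 'b::real_normed_vector"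
  shows "\<exists>L. L-lipschitz_on K f \<Longrightarrow> \<exists>L. L-lipschitz_on K g \<Longrightarrow> \<exists>L. L-lipschitz_on K (\<lambda>x. f x - g x)"
  by (blast intro: lipschitz_on_diff)

lemma ex_lipschitz_on_sum:
  fixes f :: "'i \<Rightarrow> 'a::metric_space \<Rightarrow> 'b::real_normed_vector"
  assumes "\<And>i. i \<in> I \<Longrightarrow> \<exists>L. L-lipschitz_on K (f i)"
  shows "\<exists>L. L-lipschitz_on K (\<lambda>x. \<Sum>i\<in>I. f i x)"
  using assms
proof (induction I rule: infinite_finite_induct)
  case (insert i I)
  then show ?case by (simp add: ex_lipschitz_on_add)
qed (auto intro: lipschitz_on_constant)

lemma ex_lipschitz_on_const: "\<exists>L. L-lipschitz_on K (\<lambda>x. c)"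
  using lipschitz_on_constant by blast

lemma commutator_field_lipschitz:
  assumes K: "compact K" "K \<subseteq> positive_domain"
  shows "\<exists>L. L-lipschitz_on K (\<lambda>\<mu>. \<sigma> *\<^sub>R commutator (energy_grad c \<mu>) \<mu>)"
proof -
  have id: "\<exists>L. L-lipschitz_on K (\<lambda>\<mu>. \<mu>)" using lipschitz_on_id by blast
  have inn: "\<exists>L. L-lipschitz_on K (\<lambda>\<mu>. \<mu> \<bullet> v)" for v
    by (rule lipschitz_on_bounded_bilinear[OF bounded_bilinear_inner K(1) id ex_lipschitz_on_const])
  note sc = lipschitz_on_bounded_bilinear[OF bounded_bilinear_scaleR K(1)]
  have a: "\<exists>L. L-lipschitz_on K (\<lambda>\<mu>. inverse (1 - \<mu> \<bullet> diag_unit i) *\<^sub>R diag_unit i)" for i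
    using K(2) by (intro sc ex_lipschitz_on_const lipschitz_on_inverse K(1) ex_lipschitz_on_diff inn)
      (auto simp: positive_domain_def)
  have b: "\<exists>L. L-lipschitz_on K (\<lambda>\<mu>. inverse (\<mu> \<bullet> pair_unit q) *\<^sub>R pair_unit q)"
    if "q \<in> vortex_pairs" for q
    using K(2) that by (intro sc ex_lipschitz_on_const lipschitz_on_inverse K(1) inn)
      (auto simp: positive_domain_def)
  have g: "\<exists>L. L-lipschitz_on K (energy_grad c)"
    unfolding energy_grad_def[abs_def]
    using ex_lipschitz_on_diff[OF ex_lipschitz_on_diff[OF ex_lipschitz_on_const[of K 0]
        ex_lipschitz_on_sum[of UNIV, OF a]] sc[OF ex_lipschitz_on_const[of K c] ex_lipschitz_on_sum[of vortex_pairs, OF b]]]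
    by simp
  note mm = lipschitz_on_bounded_bilinear[OF bounded_bilinear_matrix_mult K(1)]
  show ?thesis unfolding commutator_def
    by (intro sc ex_lipschitz_on_const ex_lipschitz_on_diff mm g id)
qed

section \<open>Second-order expansion of logarithms\<close>

text \<open>The function on the left, without the absolute value, has derivative s^2 / (1 + s),
  which is at most 2 t^2 between 0 and t. The mean value bound supplies the third factor.\<close>

lemma abs_ln_one_plus_cubic:
  fixes t :: real
  assumes "\<bar>t\<bar> \<le> 1/2"
  shows "\<bar>ln (1 + t) - t + t\<^sup>2 / 2\<bar> \<le> 2 * \<bar>t\<bar> ^ 3"
proof -
  define G where "G s = ln (1 + s) - s + s\<^sup>2 / 2" for s :: real
  have d: "(G has_real_derivative s\<^sup>2 / (1 + s)) (at s)" if "\<bar>s\<bar> \<le> 1/2" for s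
  proof -
    have "1 + s > 0" using that by linarith
    then show ?thesis unfolding G_def
      by (auto intro!: derivative_eq_intros simp: field_simps power2_eq_square)
  qed
  have "norm (G t - G 0) \<le> 2 * t\<^sup>2 * norm (t - 0)"
  proof (rule field_differentiable_bound[of "closed_segment 0 t"])
    fix s assume s: "s \<in> closed_segment 0 t"
    then have s': "\<bar>s\<bar> \<le> \<bar>t\<bar>" by (auto simp: closed_segment_eq_real_ivl split: if_splits)
    show "(G has_field_derivative s\<^sup>2 / (1 + s)) (at s within closed_segment 0 t)"
      using d[of s] s' assms by (auto intro: has_field_derivative_at_within)
    have "s\<^sup>2 / (1 + s) \<le> t\<^sup>2 / (1/2)"
      using s' assms by (intro frac_le) (auto simp: abs_le_square_iff[symmetric])
    moreover have "s\<^sup>2 / (1 + s) \<ge> 0" using s' assms by auto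
    ultimately show "norm (s\<^sup>2 / (1 + s)) \<le> 2 * t\<^sup>2" by (simp del: abs_divide)
  qed auto
  moreover have "2 * t\<^sup>2 * \<bar>t\<bar> = 2 * \<bar>t\<bar>^3" by (simp add: power3_eq_cube power2_eq_square)
  ultimately show ?thesis by (simp add: G_def)
qed

text \<open>With m the minimum of Q on the unit sphere, homogeneity gives Q x >= m |x|^2. This beats
  a cubic error K |x|^3 as soon as |x| < m / K.\<close>

lemma strict_local_min_of_quadratic:
  fixes f Q :: "'a::euclidean_space \<Rightarrow> real"
  assumes approx: "(\<lambda>x. f x - Q x) \<in> O[nhds 0](\<lambda>x. norm x ^ 3)"
    and hom: "\<And>t x. Q (t *\<^sub>R x) = t\<^sup>2 * Q x"
    and cont: "continuous_on UNIV Q" and pos: "\<And>x. x \<noteq> 0 \<Longrightarrow> Q x > 0"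
  shows "\<forall>\<^sub>F x in nhds 0. x \<noteq> 0 \<longrightarrow> f x > 0"
proof -
  obtain z :: 'a where z: "z \<in> sphere 0 1" "\<And>x. x \<in> sphere 0 1 \<Longrightarrow> Q z \<le> Q x"
    using continuous_attains_inf[of "sphere 0 1 :: 'a set" Q] continuous_on_subset[OF cont]
    by (metis compact_sphere not_le sphere_eq_empty subset_UNIV zero_less_one le_less_trans less_irrefl zero_le_one)
  define m where "m = Q z"
  have "z \<noteq> 0" using z(1) by auto
  then have m: "m > 0" using pos by (simp add: m_def)
  have Qm: "Q x \<ge> m * (norm x)\<^sup>2" for x
  proof (cases "x = 0")
    case False
    have "Q x = Q (norm x *\<^sub>R ((1 / norm x) *\<^sub>R x))" using False by simp
    also have "\<dots> = (norm x)\<^sup>2 * Q ((1 / norm x) *\<^sub>R x)" by (rule hom)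
    also have "\<dots> \<ge> (norm x)\<^sup>2 * m"
      unfolding m_def using False by (intro mult_left_mono z(2)) auto
    finally show ?thesis by (simp add: mult.commute)
  qed (use hom[of 0 0] in simp)
  obtain K where K: "K > 0" "\<forall>\<^sub>F x in nhds 0. norm (f x - Q x) \<le> K * norm (norm x ^ 3)"
    using approx by (elim landau_o.bigE)
  have "\<forall>\<^sub>F x in nhds (0::'a). dist x 0 < m / K" using m K
    by (auto simp: eventually_nhds_metric intro!: exI[of _ "m / K"])
  with K(2) show ?thesis
  proof eventually_elim
    case (elim x)
    show ?case
    proof
      assume x: "x \<noteq> 0"
      have "K * norm x ^ 3 = (K * norm x) * (norm x)\<^sup>2" by (simp add: power3_eq_cube power2_eq_square)
      also have "\<dots> < m * (norm x)\<^sup>2"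
        using elim(2) K x by (intro mult_strict_right_mono) (auto simp: field_simps)
      finally show "f x > 0" using elim(1) Qm[of x] by (simp add: abs_le_iff)
    qed
  qed
qed


text \<open>The filter \<open>nhds 0\<close> contains the origin, so for n > 0 membership also
  forces the value 0 there. This lets the estimates be pulled back along a map that may take the
  value 0 away from its base point.\<close>

abbreviation bigo_pow :: "nat \<Rightarrow> ('a::real_normed_vector \<Rightarrow> real) set" where
  "bigo_pow n \<equiv> O[nhds 0](\<lambda>x. norm x ^ n)"

lemma bigo_powI:
  assumes "\<And>x. norm x \<le> 1 \<Longrightarrow> \<bar>g x\<bar> \<le> K * norm x ^ n"
  shows "g \<in> bigo_pow n"
proof (rule bigoI)
  have "\<forall>\<^sub>F x in nhds (0::'a). dist x 0 < 1"
    by (auto simp: eventually_nhds_metric intro: exI[of _ 1])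
  then show "\<forall>\<^sub>F x in nhds 0. norm (g x) \<le> K * norm (norm x ^ n)"
    by eventually_elim (use assms in auto)
qed

lemma bigo_pow_mono:
  assumes "g \<in> bigo_pow m" "n \<le> m"
  shows "g \<in> bigo_pow n"
  by (rule landau_o.big_trans[OF assms(1) bigo_powI[of _ 1]]) (use assms(2) in \<open>auto intro: power_decreasing\<close>)

lemma bigo_pow_mult: "f \<in> bigo_pow m \<Longrightarrow> g \<in> bigo_pow n \<Longrightarrow> (\<lambda>x. f x * g x) \<in> bigo_pow (m + n)"
  using landau_o.big.mult[of f _ "\<lambda>x. norm x ^ m" g "\<lambda>x. norm x ^ n"] by (simp add: power_add)

lemma bigo_pow_power: "f \<in> bigo_pow 1 \<Longrightarrow> (\<lambda>x. f x ^ n) \<in> bigo_pow n"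
  using landau_o.big_power[of f _ "\<lambda>x. norm x ^ 1" n] by simp

lemma bigo_ln_cubic:
  assumes "g \<in> bigo_pow 1"
  shows "(\<lambda>x. ln (1 + g x) - g x + (g x)\<^sup>2 / 2) \<in> bigo_pow 3"
proof -
  obtain K where K: "K > 0" "\<forall>\<^sub>F x in nhds 0. norm (g x) \<le> K * norm (norm x ^ 1)"
    using assms by (elim landau_o.bigE)
  have "\<forall>\<^sub>F x in nhds (0::'a). dist x 0 < 1 / (2 * K)"
    using K by (auto simp: eventually_nhds_metric intro!: exI[of _ "1 / (2 * K)"])
  with K(2) have "\<forall>\<^sub>F x in nhds 0. norm (ln (1 + g x) - g x + (g x)\<^sup>2 / 2) \<le> 2 * K^3 * norm (norm x ^ 3)"
  proof eventually_elim
    case (elim x)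
    have "\<bar>g x\<bar> \<le> 1/2" using elim K by (auto simp: field_simps)
    then have "norm (ln (1 + g x) - g x + (g x)\<^sup>2 / 2) \<le> 2 * \<bar>g x\<bar> ^ 3"
      using abs_ln_one_plus_cubic by simp
    also have "\<dots> \<le> 2 * (K * norm x) ^ 3" using elim by (intro mult_left_mono power_mono) auto
    finally show ?case by (simp add: power_mult_distrib)
  qed
  then show ?thesis by (rule bigoI)
qed

lemma bigo_norm_linear:
  fixes e :: "'a::euclidean_space \<Rightarrow> complex"
  assumes "linear e"
  shows "(\<lambda>x. cmod (e x)) \<in> bigo_pow 1"
proof -
  obtain K where "\<And>x. norm (e x) \<le> norm x * K"
    using assms bounded_linear.bounded linear_conv_bounded_linear by blast
  then show ?thesis by (intro bigo_powI[of _ K]) (simp add: mult.commute)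
qed

lemma bigo_Re: "(\<lambda>x. cmod (e x)) \<in> bigo_pow n \<Longrightarrow> (\<lambda>x. Re (e x)) \<in> bigo_pow n"
  by (rule landau_o.big_trans[rotated]) (auto intro!: bigoI[of _ 1] always_eventually simp: abs_Re_le_cmod)

lemma norm_one_plus_sq: "(cmod (1 + e))\<^sup>2 = 1 + (2 * Re e + (cmod e)\<^sup>2)"
  unfolding cmod_power2 by (simp add: power2_eq_square algebra_simps)

lemma bigo_norm_one_plus:
  assumes "(\<lambda>x. cmod (e x)) \<in> bigo_pow 1"
  shows "(\<lambda>x. 2 * Re (e x) + (cmod (e x))\<^sup>2) \<in> bigo_pow 1"
  using bigo_Re[OF assms] bigo_pow_mono[OF bigo_pow_power[OF assms, of 2], of 1]
  by (auto intro: sum_in_bigo)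

lemma bigo_norm_one_plus_sq:
  assumes "(\<lambda>x. cmod (e x)) \<in> bigo_pow 1"
  shows "(\<lambda>x. (2 * Re (e x) + (cmod (e x))\<^sup>2)\<^sup>2 - 4 * (Re (e x))\<^sup>2) \<in> bigo_pow 3"
proof -
  have "(\<lambda>x. 4 * (Re (e x) * (cmod (e x))\<^sup>2) + (cmod (e x))^4) \<in> bigo_pow 3"
    using bigo_pow_mult[OF bigo_Re[OF assms] bigo_pow_power[OF assms, of 2]]
      bigo_pow_mono[OF bigo_pow_power[OF assms, of 4], of 3]
    by (intro sum_in_bigo) (auto simp: numeral_3_eq_3)
  then show ?thesis by (simp add: power2_sum power_mult_distrib algebra_simps flip: power_mult)
qed

text \<open>The logarithm is the real part of 2 log (1 + e), whose second-order expansion is 2 e -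
  e^2. In real terms, |e|^2 and -2 (Re e)^2 combine to - Re (e^2).\<close>

lemma bigo_ln_norm_one_plus:
  assumes "(\<lambda>x. cmod (e x)) \<in> bigo_pow 1"
  shows "(\<lambda>x. ln ((cmod (1 + e x))\<^sup>2) - (2 * Re (e x) - Re ((e x)\<^sup>2))) \<in> bigo_pow 3"
proof -
  let ?t = "\<lambda>x. 2 * Re (e x) + (cmod (e x))\<^sup>2"
  have "(\<lambda>x. (ln (1 + ?t x) - ?t x + (?t x)\<^sup>2 / 2) - ((?t x)\<^sup>2 - 4 * (Re (e x))\<^sup>2) / 2) \<in> bigo_pow 3"
    by (rule sum_in_bigo(2)[OF bigo_ln_cubic[OF bigo_norm_one_plus[OF assms]]])
      (use bigo_norm_one_plus_sq[OF assms] in simp)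
  moreover have "(ln (1 + ?t x) - ?t x + (?t x)\<^sup>2 / 2) - ((?t x)\<^sup>2 - 4 * (Re (e x))\<^sup>2) / 2
    = ln ((cmod (1 + e x))\<^sup>2) - (2 * Re (e x) - Re ((e x)\<^sup>2))" for x
  proof -
    have "Re ((e x)\<^sup>2) = 2 * (Re (e x))\<^sup>2 - (cmod (e x))\<^sup>2"
      unfolding cmod_power2 by (simp add: power2_eq_square)
    then show ?thesis unfolding norm_one_plus_sq by (simp add: algebra_simps add_divide_distrib diff_divide_distrib)
  qed
  ultimately show ?thesis by (simp only:)
qed

text \<open>The term with factor a stays exact instead of being split into orders, because it
  cancels against part of the multiplier term k tr M.\<close>

lemma bigo_ln_one_minus:
  assumes "(\<lambda>x. cmod (e x)) \<in> bigo_pow 1"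
  shows "(\<lambda>x. ln (1 - a * (2 * Re (e x) + (cmod (e x))\<^sup>2)) + a * (2 * Re (e x) + (cmod (e x))\<^sup>2)
    + 2 * a\<^sup>2 * (Re (e x))\<^sup>2) \<in> bigo_pow 3"
proof -
  let ?t = "\<lambda>x. 2 * Re (e x) + (cmod (e x))\<^sup>2"
  have "(\<lambda>x. - a * ?t x) \<in> bigo_pow 1" using bigo_norm_one_plus[OF assms] by simp
  from bigo_ln_cubic[OF this] have "(\<lambda>x. (ln (1 + - a * ?t x) - (- a * ?t x) + (- a * ?t x)\<^sup>2 / 2)
      - (a\<^sup>2 / 2) * ((?t x)\<^sup>2 - 4 * (Re (e x))\<^sup>2)) \<in> bigo_pow 3"
    by (rule sum_in_bigo(2)) (use bigo_norm_one_plus_sq[OF assms] in simp)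
  moreover have "(ln (1 + - a * ?t x) - (- a * ?t x) + (- a * ?t x)\<^sup>2 / 2)
      - (a\<^sup>2 / 2) * ((?t x)\<^sup>2 - 4 * (Re (e x))\<^sup>2)
     = ln (1 - a * ?t x) + a * ?t x + 2 * a\<^sup>2 * (Re (e x))\<^sup>2" for x
    by (simp add: algebra_simps power2_eq_square)
  ultimately show ?thesis by (simp only:)
qed

lemma bigo_ln_one_minus_sq:
  assumes "(\<lambda>x. cmod (e x)) \<in> bigo_pow 1"
  shows "(\<lambda>x. ln (1 - b * (cmod (e x))\<^sup>2) + b * (cmod (e x))\<^sup>2) \<in> bigo_pow 3"
proof -
  have "(\<lambda>x. - b * (cmod (e x))\<^sup>2) \<in> bigo_pow 1"
    using bigo_pow_mono[OF bigo_pow_power[OF assms, of 2], of 1] by simp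
  from bigo_ln_cubic[OF this]
  have "(\<lambda>x. (ln (1 + - b * (cmod (e x))\<^sup>2) - (- b * (cmod (e x))\<^sup>2) + (- b * (cmod (e x))\<^sup>2)\<^sup>2 / 2)
      - (b\<^sup>2 / 2) * (cmod (e x))^4) \<in> bigo_pow 3"
    by (rule sum_in_bigo(2)) (use bigo_pow_mono[OF bigo_pow_power[OF assms, of 4], of 3] in simp)
  moreover have "(ln (1 + - b * (cmod (e x))\<^sup>2) - (- b * (cmod (e x))\<^sup>2) + (- b * (cmod (e x))\<^sup>2)\<^sup>2 / 2)
      - (b\<^sup>2 / 2) * (cmod (e x))^4 = ln (1 - b * (cmod (e x))\<^sup>2) + b * (cmod (e x))\<^sup>2" for x
    by (simp add: algebra_simps power_mult_distrib flip: power_mult)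
  ultimately show ?thesis by (simp only:)
qed

section \<open>The Hessian at the triangle with centre\<close>

locale triangle_params =
  fixes c r :: real
  assumes c: "c > 0" and r0: "0 < r" and r1: "r < 1"
    and F6: "2 * r^4 - c * (1 - r\<^sup>2) * (2 - 3 * r\<^sup>2) < 0"
begin

definition a :: real where "a = r\<^sup>2 / (1 - r\<^sup>2)"
text \<open>The coefficient of |u|^2 in the Hessian: k r^2 = a + 2 c from the trace term, minus r^2
  from ln (1 - r^2 |u|^2). The u^2 terms of the three spokes sum to zero.\<close>

definition g :: real where "g = 2 * c + a - r\<^sup>2"

lemma r_sq: "0 < r\<^sup>2" "r\<^sup>2 < 1"
  using r0 r1 by (auto simp: power_less_one_iff)

lemma a_pos: "a > 0" using r_sq by (simp add: a_def)

lemma a_eq: "a * (1 - r\<^sup>2) = r\<^sup>2" using r_sq by (simp add: a_def)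

lemma F6': "c * (2 - 3 * r\<^sup>2) > 2 * a\<^sup>2 * (1 - r\<^sup>2)"
proof -
  have "(a * (1 - r\<^sup>2))\<^sup>2 = r^4" unfolding a_eq by simp
  then have "(2 * a\<^sup>2 * (1 - r\<^sup>2)) * (1 - r\<^sup>2) < (c * (2 - 3 * r\<^sup>2)) * (1 - r\<^sup>2)"
    using F6 by (simp add: power2_eq_square algebra_simps)
  then show ?thesis by (rule mult_right_less_imp_less) (use r_sq in simp)
qed

text \<open>Since 2 - 3 r^2 <= 2 (1 - r^2), the factor 1 - r^2 cancels in \<open>F6'\<close>. The
  bound makes the coefficient of A^2 in \<open>quad\<close> and the leading coefficient \<alpha> of
  P positive.\<close>

lemma c_gt: "c > a\<^sup>2"
proof -
  have "c * (2 - 3 * r\<^sup>2) \<le> c * (2 * (1 - r\<^sup>2))" using c r_sq by (intro mult_left_mono) auto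
  then have "a\<^sup>2 * (2 * (1 - r\<^sup>2)) < c * (2 * (1 - r\<^sup>2))" using F6' by (simp add: algebra_simps)
  then show ?thesis by (rule mult_right_less_imp_less) (use r_sq in simp)
qed

lemma g_pos: "g > 0"
proof -
  have "a - r\<^sup>2 = a * r\<^sup>2" using a_eq by (simp add: algebra_simps)
  moreover have "a * r\<^sup>2 > 0" using a_pos r_sq by simp
  ultimately show ?thesis using c by (simp add: g_def)
qed

text \<open>The Hessian splits into two copies of this form in three real variables. Its determinant is
  \<open>9 c a\<^sup>2 (c (2 - 3 r\<^sup>2) - 2 a\<^sup>2 (1 - r\<^sup>2))\<close>, which is positive exactly when \<open>F\<^sub>6 < 0\<close>.\<close>

definition P :: "real \<Rightarrow> real \<Rightarrow> real \<Rightarrow> real" where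
  "P x y z = 6*c*(x\<^sup>2 + y\<^sup>2) - 3*a\<^sup>2*(x + y)\<^sup>2 + g*z\<^sup>2 + 6*c*x*y - 6*c*x*z"

lemma P_pos:
  assumes "(x, y, z) \<noteq> (0, 0, 0)"
  shows "P x y z > 0"
proof -
  define \<alpha> \<beta> where "\<alpha> = 6*c - 3*a\<^sup>2" and "\<beta> = 3*c - 3*a\<^sup>2"
  define d where "d = 9*c*a\<^sup>2 * (c * (2 - 3 * r\<^sup>2) - 2 * a\<^sup>2 * (1 - r\<^sup>2))"
  have pos: "\<alpha> > 0" "g > 0" "d > 0"
    using c_gt c g_pos F6' a_pos by (auto simp: \<alpha>_def d_def)
  have g: "g = 2*c + a\<^sup>2 * (1 - r\<^sup>2)"
  proof -
    have "a\<^sup>2 * (1 - r\<^sup>2) = a * (a * (1 - r\<^sup>2))" by (simp add: power2_eq_square)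
    also have "\<dots> = a - r\<^sup>2" unfolding a_eq using a_eq by (simp add: algebra_simps)
    finally show ?thesis by (simp add: g_def)
  qed
  have d: "d = g * (\<alpha>\<^sup>2 - \<beta>\<^sup>2) - 9*c\<^sup>2*\<alpha>"
    by (simp add: g d_def \<alpha>_def \<beta>_def power2_eq_square algebra_simps)
  \<comment> \<open>Completing the squares in y and z leaves the determinant d as the coefficient of
    x^2.\<close>
  have "\<alpha> * g * P x y z = g * (\<alpha>*y + \<beta>*x)\<^sup>2 + \<alpha> * (g*z - 3*c*x)\<^sup>2 + d * x\<^sup>2"
    unfolding d P_def by (simp add: \<alpha>_def \<beta>_def power2_eq_square algebra_simps)
  moreover have "g * (\<alpha>*y + \<beta>*x)\<^sup>2 + \<alpha> * (g*z - 3*c*x)\<^sup>2 + d * x\<^sup>2 > 0"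
  proof (cases "x = 0")
    case True
    then have "y \<noteq> 0 \<or> z \<noteq> 0" using assms by auto
    then have "(\<alpha>*y + \<beta>*x)\<^sup>2 > 0 \<or> (g*z - 3*c*x)\<^sup>2 > 0" using True pos by simp
    then have "g * (\<alpha>*y + \<beta>*x)\<^sup>2 + \<alpha> * (g*z - 3*c*x)\<^sup>2 > 0"
      using pos by (auto intro: add_pos_nonneg add_nonneg_pos)
    then show ?thesis using True by simp
  next
    case False
    then have "d * x\<^sup>2 > 0" using pos by simp
    then show ?thesis using pos by (intro add_nonneg_pos) auto
  qed
  ultimately have "\<alpha> * g * P x y z > 0" by simp
  then show ?thesis using pos zero_less_mult_pos[of "\<alpha> * g" "P x y z"] by simp
qed

section \<open>Fourier modes of the triangle and the second-order expansion\<close>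

definition \<omega> :: complex where "\<omega> = Complex (-1/2) (sqrt 3 / 2)"

lemma \<omega>_simps: "\<omega> * cnj \<omega> = 1" "cnj \<omega> * \<omega> = 1" "\<omega> * \<omega> = cnj \<omega>" "cnj \<omega> * cnj \<omega> = \<omega>" "1 + \<omega> + cnj \<omega> = 0"
  by (auto simp: complex_eq_iff \<omega>_def)

text \<open>Points near the equilibrium are written as
  \<open>z\<^sub>j = r \<zeta> (1 + A + B \<zeta> + C cnj \<zeta>)\<close> for the three vertices \<open>\<zeta> = 1, \<omega>, cnj \<omega>\<close> and
  \<open>z\<^sub>4 = r u\<close>; the choice \<open>A \<in> \<real>\<close> fixes the phase of \<open>z\<close>. The displacements below are the relative
  changes of \<open>z\<^sub>j\<close>, of the side opposite to \<open>\<zeta>\<close>, and of \<open>z\<^sub>j - z\<^sub>4\<close>.\<close>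

definition vertex_disp :: "complex \<Rightarrow> real \<times> complex \<times> complex \<times> complex \<Rightarrow> complex" where
  "vertex_disp \<zeta> = (\<lambda>(A, B, C, u). of_real A + B * \<zeta> + C * cnj \<zeta>)"

definition side_disp :: "complex \<Rightarrow> real \<times> complex \<times> complex \<times> complex \<Rightarrow> complex" where
  "side_disp \<zeta> = (\<lambda>(A, B, C, u). of_real A - B * \<zeta>)"

definition spoke_disp :: "complex \<Rightarrow> real \<times> complex \<times> complex \<times> complex \<Rightarrow> complex" where
  "spoke_disp \<zeta> = (\<lambda>(A, B, C, u). of_real A + B * \<zeta> + C * cnj \<zeta> - cnj \<zeta> * u)"

definition centre_disp :: "real \<times> complex \<times> complex \<times> complex \<Rightarrow> complex" where
  "centre_disp = (\<lambda>(A, B, C, u). u)"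

text \<open>Threefold symmetry groups the energy by vertex: the vertex itself, the side opposite to
  it and its spoke, each relative to its equilibrium value. The factor a comes from 1 - r^2 |1 +
  w|^2 = (1 - r^2) (1 - a (2 Re w + |w|^2)), and a + 2 c is k r^2.\<close>

definition vertex_excess :: "complex \<Rightarrow> real \<times> complex \<times> complex \<times> complex \<Rightarrow> real" where
  "vertex_excess \<zeta> x = ln (1 - a * (2 * Re (vertex_disp \<zeta> x) + (cmod (vertex_disp \<zeta> x))\<^sup>2))
     + (a + 2*c) * (2 * Re (vertex_disp \<zeta> x) + (cmod (vertex_disp \<zeta> x))\<^sup>2)
     - c * ln ((cmod (1 + side_disp \<zeta> x))\<^sup>2) - c * ln ((cmod (1 + spoke_disp \<zeta> x))\<^sup>2)"

definition excess :: "real \<times> complex \<times> complex \<times> complex \<Rightarrow> real" where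
  "excess x = vertex_excess 1 x + vertex_excess \<omega> x + vertex_excess (cnj \<omega>) x
     + (ln (1 - r\<^sup>2 * (cmod (centre_disp x))\<^sup>2) + (a + 2*c) * (cmod (centre_disp x))\<^sup>2)"

text \<open>This is not yet homogeneous. The linear part is 2 c Re (2 B \<zeta> + C cnj \<zeta> + u
  cnj \<zeta>), which disappears only in the sum over the three cube roots of unity.\<close>

definition vertex_quad :: "complex \<Rightarrow> real \<times> complex \<times> complex \<times> complex \<Rightarrow> real" where
  "vertex_quad \<zeta> x = 2 * c * (2 * Re (vertex_disp \<zeta> x) + (cmod (vertex_disp \<zeta> x))\<^sup>2)
     - 2 * a\<^sup>2 * (Re (vertex_disp \<zeta> x))\<^sup>2
     - c * (2 * Re (side_disp \<zeta> x) - Re ((side_disp \<zeta> x)\<^sup>2))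
     - c * (2 * Re (spoke_disp \<zeta> x) - Re ((spoke_disp \<zeta> x)\<^sup>2))"

text \<open>Re (B \<zeta> + C cnj \<zeta>) = Re ((B + cnj C) \<zeta>), and the products surviving
  the symmetry are B C and B u. So B meets C and u through their conjugates, hence the minus signs
  in the second copy of P.\<close>

definition quad :: "real \<times> complex \<times> complex \<times> complex \<Rightarrow> real" where
  "quad = (\<lambda>(A, B, C, u). (12*c - 6*a\<^sup>2) * A\<^sup>2 + P (Re B) (Re C) (Re u) + P (Im B) (- Im C) (- Im u))"

lemma linear_disp:
  "linear (vertex_disp \<zeta>)" "linear (side_disp \<zeta>)" "linear (spoke_disp \<zeta>)" "linear centre_disp"
  by (auto intro!: linearI simp: vertex_disp_def side_disp_def spoke_disp_def centre_disp_def
      algebra_simps scaleR_conv_of_real split: prod.splits)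

lemmas disp_bigo = linear_disp[THEN bigo_norm_linear]

lemma vertex_excess_approx: "(\<lambda>x. vertex_excess \<zeta> x - vertex_quad \<zeta> x) \<in> bigo_pow 3"
proof -
  let ?w = "vertex_disp \<zeta>" and ?e = "side_disp \<zeta>" and ?f = "spoke_disp \<zeta>"
  have "(\<lambda>x. (ln (1 - a * (2 * Re (?w x) + (cmod (?w x))\<^sup>2))
      + a * (2 * Re (?w x) + (cmod (?w x))\<^sup>2) + 2 * a\<^sup>2 * (Re (?w x))\<^sup>2)
      - c * (ln ((cmod (1 + ?e x))\<^sup>2) - (2 * Re (?e x) - Re ((?e x)\<^sup>2)))
      - c * (ln ((cmod (1 + ?f x))\<^sup>2) - (2 * Re (?f x) - Re ((?f x)\<^sup>2)))) \<in> bigo_pow 3"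
    by (intro sum_in_bigo(2) bigo_ln_one_minus disp_bigo)
      (use bigo_ln_norm_one_plus[OF disp_bigo(2)] bigo_ln_norm_one_plus[OF disp_bigo(3)] in auto)
  then show ?thesis
    by (rule back_subst[of "\<lambda>f. f \<in> bigo_pow 3"])
      (simp add: vertex_excess_def vertex_quad_def fun_eq_iff algebra_simps)
qed

text \<open>Summing over \<zeta> = 1, \<omega>, cnj \<omega> kills every term that still carries
  \<zeta> or its conjugate. The check is done in real coordinates, with q for sqrt 3 so that q q = 3
  is the only relation to apply.\<close>

lemma quad_eq:
  "quad x = vertex_quad 1 x + vertex_quad \<omega> x + vertex_quad (cnj \<omega>) x + g * (cmod (centre_disp x))\<^sup>2"
proof -
  define q :: real where "q = sqrt 3"
  have q: "q * q = 3" by (simp add: q_def)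
  have q': "q * (q * y) = 3 * y" for y by (simp add: q flip: mult.assoc)
  obtain A B C u where x: "x = (A, B, C, u)" by (cases x) auto
  show ?thesis
    unfolding quad_def vertex_quad_def vertex_disp_def side_disp_def spoke_disp_def centre_disp_def
      cmod_power2 P_def x \<omega>_def q_def[symmetric]
    by (simp add: power2_eq_square) (simp add: field_simps q q')
qed

lemma excess_approx: "(\<lambda>x. excess x - quad x) \<in> bigo_pow 3"
proof -
  have "(\<lambda>x. (vertex_excess 1 x - vertex_quad 1 x) + (vertex_excess \<omega> x - vertex_quad \<omega> x)
    + (vertex_excess (cnj \<omega>) x - vertex_quad (cnj \<omega>) x)
    + (ln (1 - r\<^sup>2 * (cmod (centre_disp x))\<^sup>2) + r\<^sup>2 * (cmod (centre_disp x))\<^sup>2)) \<in> bigo_pow 3"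
    by (intro sum_in_bigo(1) vertex_excess_approx bigo_ln_one_minus_sq disp_bigo)
  then show ?thesis
    by (rule back_subst[of "\<lambda>f. f \<in> bigo_pow 3"])
      (simp add: excess_def quad_eq g_def fun_eq_iff algebra_simps)
qed

lemma quad_pos:
  assumes "x \<noteq> 0"
  shows "quad x > 0"
proof -
  obtain A B C u where x: "x = (A, B, C, u)" by (cases x) auto
  have nn: "P b d e \<ge> 0" for b d e using P_pos[of b d e] by (cases "(b, d, e) = (0, 0, 0)") (auto simp: P_def)
  have k: "12*c - 6*a\<^sup>2 > 0" using c_gt c by simp
  have "A \<noteq> 0 \<or> (Re B, Re C, Re u) \<noteq> (0,0,0) \<or> (Im B, - Im C, - Im u) \<noteq> (0,0,0)"
    using assms by (auto simp: x zero_prod_def complex_eq_iff)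
  then have "(12*c - 6*a\<^sup>2) * A\<^sup>2 > 0 \<or> P (Re B) (Re C) (Re u) > 0 \<or> P (Im B) (- Im C) (- Im u) > 0"
    using k P_pos by auto
  moreover have "(12*c - 6*a\<^sup>2) * A\<^sup>2 \<ge> 0" using k by simp
  ultimately show ?thesis
    using nn[of "Re B" "Re C" "Re u"] nn[of "Im B" "- Im C" "- Im u"] by (auto simp: quad_def x)
qed

lemma excess_pos: "\<forall>\<^sub>F x in nhds 0. x \<noteq> 0 \<longrightarrow> excess x > 0"
proof (rule strict_local_min_of_quadratic[OF excess_approx])
  show "quad (t *\<^sub>R x) = t\<^sup>2 * quad x" for t x
    by (cases x) (simp add: quad_def P_def power2_eq_square algebra_simps)
  show "continuous_on UNIV quad"
    unfolding quad_def P_def case_prod_beta by (intro continuous_intros)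
qed (rule quad_pos)

end

section \<open>Strict minimality and stability\<close>

lemma rank_one_if_factor:
  fixes \<mu> :: "complex^'n^'n"
  assumes \<mu>: "\<And>i j. \<mu>$i$j = u i * v j" and nz: "\<mu> \<noteq> 0"
  shows "rank \<mu> = 1"
proof -
  have "rows \<mu> \<subseteq> vec.span {\<chi> j. v j}"
    using \<mu> by (auto simp: vec.span_singleton rows_def row_def vec_eq_iff)
  then have "vec.dim (rows \<mu>) \<le> 1" using vec.dim_le_card[of "rows \<mu>" "{\<chi> j. v j}"] by simp
  moreover have "vec.dim (rows \<mu>) \<noteq> 0"
  proof
    assume "vec.dim (rows \<mu>) = 0"
    then have "rows \<mu> \<subseteq> {0}" by (simp add: vec.dim_eq_0)
    then have "row i \<mu> = 0" for i unfolding rows_def by blast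
    then have "\<mu> = 0" by (simp add: row_def vec_eq_iff)
    then show False using nz by simp
  qed
  ultimately show ?thesis unfolding row_rank_def_gen by linarith
qed

lemma cnj_ment: "\<mu> \<in> skew_hermitian \<Longrightarrow> cnj (ment \<mu> i j) = ment \<mu> j i"
  by (simp add: ment_def skew_hermitian_iff)

lemma ment_minors: "\<mu> \<in> vanishing_minors \<Longrightarrow> ment \<mu> i j * ment \<mu> k l = ment \<mu> i l * ment \<mu> k j"
  by (simp add: ment_def vanishing_minors_def)

lemma eq_if_ment_eq: "(\<And>i j. ment \<mu> i j = ment \<nu> i j) \<Longrightarrow> \<mu> = \<nu>"
  by (simp add: ment_def vec_eq_iff)

lemma sqdist_factor:
  assumes "\<And>i j. ment \<mu> i j = z i * cnj (z j)"
  shows "sqdist \<mu> i j = (cmod (z i - z j))\<^sup>2"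
  unfolding sqdist_def assms cmod_power2 by (simp add: power2_eq_square algebra_simps)

context triangle_params
begin

definition z0 :: "4 \<Rightarrow> complex" where
  "z0 i = of_real r * (if i = 1 then 1 else if i = 2 then \<omega> else if i = 3 then cnj \<omega> else 0)"

lemma z0_simps [simp]:
  "z0 1 = of_real r" "z0 2 = of_real r * \<omega>" "z0 3 = of_real r * cnj \<omega>" "z0 4 = 0"
  by (simp_all add: z0_def)

abbreviation p :: cmat4 where "p \<equiv> triangle_with_center r"

lemma ment_p: "ment p i j = z0 i * cnj (z0 j)"
proof -
  have "exp (2 * of_real pi * \<i> / 3) = cis (2 * pi / 3)"
    by (simp add: cis_conv_exp mult_ac)
  also have "\<dots> = \<omega>" by (simp add: complex_eq_iff \<omega>_def cos_120 sin_120)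
  finally have e: "exp (2 * of_real pi * \<i> / 3) = \<omega>" .
  show ?thesis
    unfolding triangle_with_center_def e Let_def ment_def map_matrix_def
    using exhaust_4[of i] exhaust_4[of j]
    by (auto simp: power2_eq_square complex_eq_iff \<omega>_def) (simp_all add: field_simps)
qed

lemma p_entry: "p $ i $ j = \<i> * z0 i * cnj (z0 j)"
  using ment_p[of i j] by (simp add: ment_def complex_eq_iff)

lemma p_skew: "p \<in> skew_hermitian"
  by (simp add: skew_hermitian_iff p_entry)

lemma p_rank_one: "p \<in> rank_one"
proof -
  have "p $ 1 $ 1 \<noteq> 0" using r0 by (simp add: p_entry)
  then have "p \<noteq> 0" by (metis zero_index)
  then have "rank p = 1" by (rule rank_one_if_factor[OF p_entry])
  then show ?thesis by (simp add: rank_one_def p_skew)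
qed

lemma norm_diffs: "(cmod (1 - \<omega>))\<^sup>2 = 3" "(cmod (1 - cnj \<omega>))\<^sup>2 = 3" "(cmod (\<omega> - cnj \<omega>))\<^sup>2 = 3" "cmod \<omega> = 1"
  unfolding cmod_power2 by (simp_all add: \<omega>_def power2_eq_square cmod_def)

lemma p_diag: "p \<bullet> diag_unit i = (if i = 4 then 0 else r\<^sup>2)"
  using exhaust_4[of i] by (auto simp: inner_diag_unit ment_p power2_eq_square \<omega>_simps mult_ac)
    (auto simp: complex_eq_iff \<omega>_def)

lemma p_pair:
  "p \<bullet> pair_unit (1,2) = 3 * r\<^sup>2" "p \<bullet> pair_unit (1,3) = 3 * r\<^sup>2" "p \<bullet> pair_unit (2,3) = 3 * r\<^sup>2"
  "p \<bullet> pair_unit (1,4) = r\<^sup>2" "p \<bullet> pair_unit (2,4) = r\<^sup>2" "p \<bullet> pair_unit (3,4) = r\<^sup>2"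
  by (simp_all add: inner_pair_unit[OF p_skew] vortex_pairs_def sqdist_factor[OF ment_p]
      norm_diffs norm_mult power_mult_distrib flip: right_diff_distrib)
     (simp_all add: right_diff_distrib[symmetric, of "of_real r" 1, simplified] norm_mult power_mult_distrib norm_diffs)

lemma p_positive_domain: "p \<in> positive_domain"
  using r_sq by (auto simp: positive_domain_def vortex_pairs_def p_diag p_pair)

definition k :: real where "k = 1 / (1 - r\<^sup>2) + 2 * c / r\<^sup>2"

lemma k_eq: "k * r\<^sup>2 = a + 2 * c"
  using r_sq by (simp add: k_def a_def distrib_right)

text \<open>The equilibrium condition, and the origin of k. Together with its adjoint form it makes
  i z0 z0^* commute with the gradient, so the equilibrium is a fixed point.\<close>

lemma grad_eigenvector: "(\<Sum>j\<in>UNIV. energy_grad c p $ i $ j * z0 j) = - \<i> * of_real k * z0 i"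
proof -
  define X Y where "X = inverse (1 - r\<^sup>2)" and "Y = inverse (r\<^sup>2)"
  have k: "k = X + 2 * c * Y" by (simp add: k_def X_def Y_def inverse_eq_divide)
  have i: "inverse (1 - r\<^sup>2) = X" "inverse (3 * r\<^sup>2) = Y / 3" "inverse (r\<^sup>2) = Y"
    by (simp_all add: X_def Y_def inverse_eq_divide)
  have E: "energy_grad c p = - (X *\<^sub>R diag_unit 1 + X *\<^sub>R diag_unit 2 + X *\<^sub>R diag_unit 3 + diag_unit 4)
    - c *\<^sub>R ((Y/3) *\<^sub>R pair_unit (1,2) + ((Y/3) *\<^sub>R pair_unit (1,3) + (Y *\<^sub>R pair_unit (1,4)
      + ((Y/3) *\<^sub>R pair_unit (2,3) + (Y *\<^sub>R pair_unit (2,4) + Y *\<^sub>R pair_unit (3,4))))))"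
    unfolding energy_grad_def sum_4 sum_vortex_pairs p_diag p_pair i by (simp add: i)
  define e :: "4 \<Rightarrow> 4 \<Rightarrow> real" where "e i j = (if i = j then (if i = 4 then - 1 - 3*c*Y else - X - 5*c*Y/3)
    else if i = 4 \<or> j = 4 then c*Y else c*Y/3)" for i j
  have entry: "energy_grad c p $ i $ j = \<i> * of_real (e i j)" for i j
    unfolding E using exhaust_4[of i] exhaust_4[of j]
    by (elim disjE) (simp_all add: e_def diag_unit_def pair_unit_def complex_eq_iff)
  show ?thesis
    unfolding entry sum_4 k using exhaust_4[of i]
    by (elim disjE) (simp_all add: e_def \<omega>_def complex_eq_iff algebra_simps)
qed

lemma grad_eigenvector': "(\<Sum>i\<in>UNIV. cnj (z0 i) * energy_grad c p $ i $ j) = - \<i> * of_real k * cnj (z0 j)"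
proof -
  have "energy_grad c p $ i $ j = - cnj (energy_grad c p $ j $ i)" for i
    using energy_grad_skew[of c p] by (simp add: skew_hermitian_iff)
  then have "(\<Sum>i\<in>UNIV. cnj (z0 i) * energy_grad c p $ i $ j)
      = - cnj (\<Sum>i\<in>UNIV. energy_grad c p $ j $ i * z0 i)"
    by (simp add: sum_negf mult.commute)
  then show ?thesis unfolding grad_eigenvector by simp
qed

lemma commutator_p: "commutator (energy_grad c p) p = 0"
proof -
  have "(energy_grad c p ** p) $ i $ j = (p ** energy_grad c p) $ i $ j" for i j
  proof -
    have "(energy_grad c p ** p) $ i $ j = (\<Sum>l\<in>UNIV. energy_grad c p $ i $ l * z0 l) * (\<i> * cnj (z0 j))"
      unfolding sum_distrib_right by (simp add: matrix_matrix_mult_def p_entry mult_ac)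
    also have "\<dots> = (\<i> * z0 i) * (\<Sum>l\<in>UNIV. cnj (z0 l) * energy_grad c p $ l $ j)"
      unfolding grad_eigenvector grad_eigenvector' by (simp add: mult_ac)
    also have "\<dots> = (p ** energy_grad c p) $ i $ j"
      unfolding sum_distrib_left by (simp add: matrix_matrix_mult_def p_entry mult_ac)
    finally show ?thesis .
  qed
  then show ?thesis by (simp add: commutator_def vec_eq_iff)
qed

section \<open>Recovering the vortex positions from the matrix\<close>

definition nform :: "cmat4 \<Rightarrow> complex" where
  "nform \<mu> = (\<Sum>m\<in>UNIV. \<Sum>l\<in>UNIV. cnj (z0 m) * ment \<mu> m l * z0 l)"

text \<open>If \<open>\<mu> = \<i> z z\<^sup>*\<close>, this recovers \<open>z\<close> with the phase for which \<open>z0\<^sup>* z > 0\<close>.\<close>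

definition zeta :: "cmat4 \<Rightarrow> 4 \<Rightarrow> complex" where
  "zeta \<mu> i = (\<Sum>l\<in>UNIV. ment \<mu> i l * z0 l) / of_real (sqrt (Re (nform \<mu>)))"

text \<open>The inverse discrete Fourier transform of \<open>zeta\<close> over the triangle,
  relative to the rotating reference \<open>z0\<close>. The first component can be read off as a
  real number because the phase normalization makes z0^* \<open>zeta\<close> equal to the square
  root of \<open>nform\<close>; 3 r^2 is the squared norm of \<open>z0\<close>.\<close>

definition params :: "cmat4 \<Rightarrow> real \<times> complex \<times> complex \<times> complex" where
  "params \<mu> = (sqrt (Re (nform \<mu>)) / (3 * r\<^sup>2) - 1,
     (zeta \<mu> 1 + \<omega> * zeta \<mu> 2 + cnj \<omega> * zeta \<mu> 3) / (3 * of_real r),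
     (zeta \<mu> 1 + zeta \<mu> 2 + zeta \<mu> 3) / (3 * of_real r),
     zeta \<mu> 4 / of_real r)"

lemma nform_real:
  assumes "\<mu> \<in> skew_hermitian"
  shows "nform \<mu> = of_real (Re (nform \<mu>))"
proof -
  have "cnj (nform \<mu>) = (\<Sum>m\<in>UNIV. \<Sum>l\<in>UNIV. cnj (z0 l) * ment \<mu> l m * z0 m)"
    by (simp add: nform_def cnj_ment[OF assms] mult_ac)
  also have "\<dots> = nform \<mu>" unfolding nform_def by (rule sum.swap)
  finally show ?thesis by (metis Reals_cnj_iff of_real_Re)
qed

context
  fixes \<mu> :: cmat4
  assumes skew: "\<mu> \<in> skew_hermitian" and minors: "\<mu> \<in> vanishing_minors" and nf: "Re (nform \<mu>) > 0"
begin

text \<open>Vanishing minors allow M_il M_mj to be rewritten as M_ij M_ml, so (M z0) (M z0)^* =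
  (z0^* M z0) M. Vanishing minors alone would also admit M = 0 and M = - z z^*; positivity of
  \<open>nform\<close> excludes both.\<close>

lemma ment_zeta: "ment \<mu> i j = zeta \<mu> i * cnj (zeta \<mu> j)"
proof -
  have "(\<Sum>l\<in>UNIV. ment \<mu> i l * z0 l) * cnj (\<Sum>m\<in>UNIV. ment \<mu> j m * z0 m)
      = (\<Sum>l\<in>UNIV. \<Sum>m\<in>UNIV. (ment \<mu> i l * ment \<mu> m j) * (z0 l * cnj (z0 m)))"
    by (simp add: sum_product cnj_ment[OF skew] mult_ac)
  also have "\<dots> = (\<Sum>l\<in>UNIV. \<Sum>m\<in>UNIV. (ment \<mu> i j * ment \<mu> m l) * (z0 l * cnj (z0 m)))"
    unfolding ment_minors[OF minors, of i j _ _, symmetric] ..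
  also have "\<dots> = ment \<mu> i j * (\<Sum>l\<in>UNIV. \<Sum>m\<in>UNIV. cnj (z0 m) * ment \<mu> m l * z0 l)"
    by (simp add: sum_distrib_left mult_ac)
  also have "\<dots> = ment \<mu> i j * nform \<mu>" unfolding nform_def by (subst sum.swap) rule
  finally have "zeta \<mu> i * cnj (zeta \<mu> j)
      = ment \<mu> i j * nform \<mu> / (of_real (sqrt (Re (nform \<mu>))) * of_real (sqrt (Re (nform \<mu>))))"
    by (simp add: zeta_def)
  also have "of_real (sqrt (Re (nform \<mu>))) * of_real (sqrt (Re (nform \<mu>))) = nform \<mu>"
    using nf nform_real[OF skew] by (simp flip: of_real_mult)
  finally show ?thesis using nf by (auto simp: complex_eq_iff)
qed

lemma zeta_A: "zeta \<mu> 1 + cnj \<omega> * zeta \<mu> 2 + \<omega> * zeta \<mu> 3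
  = 3 * of_real r * (1 + of_real (fst (params \<mu>)))"
proof -
  let ?s = "sqrt (Re (nform \<mu>))"
  have "(\<Sum>m\<in>UNIV. cnj (z0 m) * zeta \<mu> m) = nform \<mu> / of_real ?s"
    by (simp add: nform_def zeta_def sum_distrib_left sum_divide_distrib mult_ac)
  also have "\<dots> = of_real (Re (nform \<mu>) / ?s)" using nform_real[OF skew] by simp
  also have "Re (nform \<mu>) / ?s = ?s" using nf by (simp add: real_div_sqrt)
  finally have "of_real r * (zeta \<mu> 1 + cnj \<omega> * zeta \<mu> 2 + \<omega> * zeta \<mu> 3) = of_real ?s"
    by (simp add: sum_4 algebra_simps)
  then show ?thesis using r0
    by (simp add: params_def field_simps power2_eq_square)
qed

lemma zeta_params:
  assumes "params \<mu> = (A, B, C, u)"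
  shows "zeta \<mu> 1 = of_real r * (1 + of_real A + B + C)"
    "zeta \<mu> 2 = of_real r * (\<omega> * (1 + of_real A) + cnj \<omega> * B + C)"
    "zeta \<mu> 3 = of_real r * (cnj \<omega> * (1 + of_real A) + \<omega> * B + C)"
    "zeta \<mu> 4 = of_real r * u"
proof -
  have A: "zeta \<mu> 1 + cnj \<omega> * zeta \<mu> 2 + \<omega> * zeta \<mu> 3 = 3 * of_real r * (1 + of_real A)"
    using zeta_A assms by simp
  have B: "zeta \<mu> 1 + \<omega> * zeta \<mu> 2 + cnj \<omega> * zeta \<mu> 3 = 3 * of_real r * B"
    and C: "zeta \<mu> 1 + zeta \<mu> 2 + zeta \<mu> 3 = 3 * of_real r * C"
    using assms r0 by (auto simp: params_def)
  show "zeta \<mu> 4 = of_real r * u" using assms r0 by (auto simp: params_def)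
  show "zeta \<mu> 1 = of_real r * (1 + of_real A + B + C)"
    using A B C \<omega>_simps by algebra
  show "zeta \<mu> 2 = of_real r * (\<omega> * (1 + of_real A) + cnj \<omega> * B + C)"
    using A B C \<omega>_simps by algebra
  show "zeta \<mu> 3 = of_real r * (cnj \<omega> * (1 + of_real A) + \<omega> * B + C)"
    using A B C \<omega>_simps by algebra
qed

text \<open>The mode C adds the same vector r C to all three vertices. Being a translation of the
  triangle, it drops out of the sides.\<close>

lemma zeta_disp:
  "zeta \<mu> 1 = of_real r * (1 + vertex_disp 1 (params \<mu>))"
  "zeta \<mu> 2 = of_real r * \<omega> * (1 + vertex_disp \<omega> (params \<mu>))"
  "zeta \<mu> 3 = of_real r * cnj \<omega> * (1 + vertex_disp (cnj \<omega>) (params \<mu>))"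
  "zeta \<mu> 4 = of_real r * centre_disp (params \<mu>)"
  "zeta \<mu> 2 - zeta \<mu> 3 = of_real r * (\<omega> - cnj \<omega>) * (1 + side_disp 1 (params \<mu>))"
  "zeta \<mu> 1 - zeta \<mu> 3 = of_real r * (1 - cnj \<omega>) * (1 + side_disp \<omega> (params \<mu>))"
  "zeta \<mu> 1 - zeta \<mu> 2 = of_real r * (1 - \<omega>) * (1 + side_disp (cnj \<omega>) (params \<mu>))"
  "zeta \<mu> 1 - zeta \<mu> 4 = of_real r * (1 + spoke_disp 1 (params \<mu>))"
  "zeta \<mu> 2 - zeta \<mu> 4 = of_real r * \<omega> * (1 + spoke_disp \<omega> (params \<mu>))"
  "zeta \<mu> 3 - zeta \<mu> 4 = of_real r * cnj \<omega> * (1 + spoke_disp (cnj \<omega>) (params \<mu>))"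
proof -
  obtain A B C u where x: "params \<mu> = (A, B, C, u)" by (metis prod_cases4)
  note z = zeta_params[OF x]
  note d = x vertex_disp_def side_disp_def spoke_disp_def centre_disp_def prod.case complex_cnj_cnj complex_cnj_one
  show "zeta \<mu> 1 = of_real r * (1 + vertex_disp 1 (params \<mu>))"
    unfolding z d by algebra
  show "zeta \<mu> 2 = of_real r * \<omega> * (1 + vertex_disp \<omega> (params \<mu>))"
    unfolding z d using \<omega>_simps by algebra
  show "zeta \<mu> 3 = of_real r * cnj \<omega> * (1 + vertex_disp (cnj \<omega>) (params \<mu>))"
    unfolding z d using \<omega>_simps by algebra
  show "zeta \<mu> 4 = of_real r * centre_disp (params \<mu>)"
    unfolding z d ..
  show "zeta \<mu> 2 - zeta \<mu> 3 = of_real r * (\<omega> - cnj \<omega>) * (1 + side_disp 1 (params \<mu>))"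
    unfolding z d by (simp add: algebra_simps)
  show "zeta \<mu> 1 - zeta \<mu> 3 = of_real r * (1 - cnj \<omega>) * (1 + side_disp \<omega> (params \<mu>))"
    unfolding z d using \<omega>_simps by algebra
  show "zeta \<mu> 1 - zeta \<mu> 2 = of_real r * (1 - \<omega>) * (1 + side_disp (cnj \<omega>) (params \<mu>))"
    unfolding z d using \<omega>_simps by algebra
  show "zeta \<mu> 1 - zeta \<mu> 4 = of_real r * (1 + spoke_disp 1 (params \<mu>))"
    unfolding z d by algebra
  show "zeta \<mu> 2 - zeta \<mu> 4 = of_real r * \<omega> * (1 + spoke_disp \<omega> (params \<mu>))"
    unfolding z d using \<omega>_simps by algebra
  show "zeta \<mu> 3 - zeta \<mu> 4 = of_real r * cnj \<omega> * (1 + spoke_disp (cnj \<omega>) (params \<mu>))"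
    unfolding z d using \<omega>_simps by algebra
qed

lemma eq_p_if_params_zero:
  assumes "params \<mu> = 0"
  shows "\<mu> = p"
proof (rule eq_if_ment_eq)
  fix i j
  have "params \<mu> = (0, 0, 0, 0)" using assms by (simp add: zero_prod_def)
  then have "zeta \<mu> i = z0 i" for i
    using zeta_params[of 0 0 0 0] exhaust_4[of i] by auto
  then show "ment \<mu> i j = ment p i j" by (simp add: ment_zeta ment_p)
qed

text \<open>By \<open>zeta_disp\<close>, every argument of a logarithm except the one for the centre
  is its equilibrium value times a relative factor. Membership in the positive domain makes these
  factors positive, so the logarithms split and the equilibrium values collect in the
  constant.\<close>

lemma lyapunov_fun_excess:
  assumes dom: "\<mu> \<in> positive_domain"
  shows "lyapunov_fun c k \<mu> = 3 * ln (1 - r\<^sup>2) - 3 * c * ln (3 * r\<^sup>2) - 3 * c * ln (r\<^sup>2) + 3 * k * r\<^sup>2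
    + excess (params \<mu>)"
proof -
  let ?x = "params \<mu>"
  let ?s = "\<lambda>w. 2 * Re w + (cmod w)\<^sup>2"
  have d: "\<mu> \<bullet> diag_unit i = (cmod (zeta \<mu> i))\<^sup>2" for i
    unfolding inner_diag_unit ment_zeta complex_norm_square[symmetric] by simp
  have q: "\<mu> \<bullet> pair_unit (i, j) = (cmod (zeta \<mu> i - zeta \<mu> j))\<^sup>2" if "(i, j) \<in> vortex_pairs" for i j
    using inner_pair_unit[OF skew that] sqdist_factor[OF ment_zeta] by simp
  have d1: "(cmod (zeta \<mu> i))\<^sup>2 < 1" for i using dom d by (simp add: positive_domain_def)
  have vert: "ln (1 - r\<^sup>2 * (cmod (1 + w))\<^sup>2) = ln (1 - r\<^sup>2) + ln (1 - a * ?s w)"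
    if "r\<^sup>2 * (cmod (1 + w))\<^sup>2 < 1" for w
  proof -
    have "1 - r\<^sup>2 * (cmod (1 + w))\<^sup>2 = 1 - r\<^sup>2 - (a * (1 - r\<^sup>2)) * ?s w"
      unfolding norm_one_plus_sq a_eq by (simp add: algebra_simps)
    also have "\<dots> = (1 - r\<^sup>2) * (1 - a * ?s w)" by (simp add: algebra_simps)
    finally have e: "1 - r\<^sup>2 * (cmod (1 + w))\<^sup>2 = (1 - r\<^sup>2) * (1 - a * ?s w)" .
    then have "(1 - r\<^sup>2) * (1 - a * ?s w) > 0" using that by linarith
    then have "1 - a * ?s w > 0" using r_sq by (simp add: zero_less_mult_iff)
    then show ?thesis unfolding e using r_sq by (intro ln_mult_pos) auto
  qed
  have z: "(cmod (zeta \<mu> 1))\<^sup>2 = r\<^sup>2 * (cmod (1 + vertex_disp 1 ?x))\<^sup>2"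
    "(cmod (zeta \<mu> 2))\<^sup>2 = r\<^sup>2 * (cmod (1 + vertex_disp \<omega> ?x))\<^sup>2"
    "(cmod (zeta \<mu> 3))\<^sup>2 = r\<^sup>2 * (cmod (1 + vertex_disp (cnj \<omega>) ?x))\<^sup>2"
    "(cmod (zeta \<mu> 4))\<^sup>2 = r\<^sup>2 * (cmod (centre_disp ?x))\<^sup>2"
    unfolding zeta_disp by (simp_all add: norm_mult power_mult_distrib norm_diffs)
  have lnd: "ln (1 - (cmod (zeta \<mu> 1))\<^sup>2) = ln (1 - r\<^sup>2) + ln (1 - a * ?s (vertex_disp 1 ?x))"
    "ln (1 - (cmod (zeta \<mu> 2))\<^sup>2) = ln (1 - r\<^sup>2) + ln (1 - a * ?s (vertex_disp \<omega> ?x))"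
    "ln (1 - (cmod (zeta \<mu> 3))\<^sup>2) = ln (1 - r\<^sup>2) + ln (1 - a * ?s (vertex_disp (cnj \<omega>) ?x))"
    using d1[of 1] d1[of 2] d1[of 3] unfolding z by (auto intro: vert)
  have kd: "k * (r\<^sup>2 * (cmod (1 + w))\<^sup>2) = k * r\<^sup>2 + (a + 2*c) * ?s w" for w
    unfolding norm_one_plus_sq k_eq[symmetric] by (simp add: algebra_simps)
  have kz: "k * (r\<^sup>2 * (cmod w)\<^sup>2) = (a + 2*c) * (cmod w)\<^sup>2" for w
    unfolding k_eq[symmetric] by simp
  have pos: "(cmod (zeta \<mu> i - zeta \<mu> j))\<^sup>2 > 0" if "(i, j) \<in> vortex_pairs" for i j
    using dom q[OF that] that by (auto simp: positive_domain_def)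
  have side: "ln ((cmod (of_real r * t * (1 + w)))\<^sup>2) = ln (3 * r\<^sup>2) + ln ((cmod (1 + w))\<^sup>2)"
    if "(cmod (of_real r * t * (1 + w)))\<^sup>2 > 0" "(cmod t)\<^sup>2 = 3" for t w
  proof -
    have "(cmod (of_real r * t * (1 + w)))\<^sup>2 = (3 * r\<^sup>2) * (cmod (1 + w))\<^sup>2"
      by (simp add: norm_mult power_mult_distrib that(2))
    moreover have "(cmod (1 + w))\<^sup>2 > 0" using that by auto
    ultimately show ?thesis using r_sq by (metis ln_mult_pos mult_pos_pos zero_less_numeral)
  qed
  have spoke: "ln ((cmod (of_real r * t * (1 + w)))\<^sup>2) = ln (r\<^sup>2) + ln ((cmod (1 + w))\<^sup>2)"
    if "(cmod (of_real r * t * (1 + w)))\<^sup>2 > 0" "cmod t = 1" for t w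
  proof -
    have "(cmod (of_real r * t * (1 + w)))\<^sup>2 = r\<^sup>2 * (cmod (1 + w))\<^sup>2"
      by (simp add: norm_mult power_mult_distrib that(2))
    moreover have "(cmod (1 + w))\<^sup>2 > 0" using that by auto
    ultimately show ?thesis using r_sq by (metis ln_mult_pos)
  qed
  have lnq: "ln ((cmod (zeta \<mu> 1 - zeta \<mu> 2))\<^sup>2) = ln (3 * r\<^sup>2) + ln ((cmod (1 + side_disp (cnj \<omega>) ?x))\<^sup>2)"
    "ln ((cmod (zeta \<mu> 1 - zeta \<mu> 3))\<^sup>2) = ln (3 * r\<^sup>2) + ln ((cmod (1 + side_disp \<omega> ?x))\<^sup>2)"
    "ln ((cmod (zeta \<mu> 2 - zeta \<mu> 3))\<^sup>2) = ln (3 * r\<^sup>2) + ln ((cmod (1 + side_disp 1 ?x))\<^sup>2)"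
    "ln ((cmod (zeta \<mu> 1 - zeta \<mu> 4))\<^sup>2) = ln (r\<^sup>2) + ln ((cmod (1 + spoke_disp 1 ?x))\<^sup>2)"
    "ln ((cmod (zeta \<mu> 2 - zeta \<mu> 4))\<^sup>2) = ln (r\<^sup>2) + ln ((cmod (1 + spoke_disp \<omega> ?x))\<^sup>2)"
    "ln ((cmod (zeta \<mu> 3 - zeta \<mu> 4))\<^sup>2) = ln (r\<^sup>2) + ln ((cmod (1 + spoke_disp (cnj \<omega>) ?x))\<^sup>2)"
    using pos[of 1 2] pos[of 1 3] pos[of 2 3] pos[of 1 4] pos[of 2 4] pos[of 3 4]
      side[of "1 - \<omega>" "side_disp (cnj \<omega>) ?x"] side[of "1 - cnj \<omega>" "side_disp \<omega> ?x"]
      side[of "\<omega> - cnj \<omega>" "side_disp 1 ?x"] spoke[of 1 "spoke_disp 1 ?x"]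
      spoke[of \<omega> "spoke_disp \<omega> ?x"] spoke[of "cnj \<omega>" "spoke_disp (cnj \<omega>) ?x"]
    unfolding zeta_disp(5-10) by (simp_all add: vortex_pairs_def norm_diffs)
  have "lyapunov_fun c k \<mu> = (ln (1 - (cmod (zeta \<mu> 1))\<^sup>2) + ln (1 - (cmod (zeta \<mu> 2))\<^sup>2)
      + ln (1 - (cmod (zeta \<mu> 3))\<^sup>2) + ln (1 - (cmod (zeta \<mu> 4))\<^sup>2))
    - c * (ln ((cmod (zeta \<mu> 1 - zeta \<mu> 2))\<^sup>2) + ln ((cmod (zeta \<mu> 1 - zeta \<mu> 3))\<^sup>2)
      + ln ((cmod (zeta \<mu> 1 - zeta \<mu> 4))\<^sup>2) + ln ((cmod (zeta \<mu> 2 - zeta \<mu> 3))\<^sup>2)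
      + ln ((cmod (zeta \<mu> 2 - zeta \<mu> 4))\<^sup>2) + ln ((cmod (zeta \<mu> 3 - zeta \<mu> 4))\<^sup>2))
    + (k * (cmod (zeta \<mu> 1))\<^sup>2 + k * (cmod (zeta \<mu> 2))\<^sup>2 + k * (cmod (zeta \<mu> 3))\<^sup>2 + k * (cmod (zeta \<mu> 4))\<^sup>2)"
    unfolding lyapunov_fun_def log_energy_def sum_vortex_pairs sum_4 d
    by (simp add: q vortex_pairs_def distrib_left)
  also have "\<dots> = 3 * ln (1 - r\<^sup>2) - 3 * c * ln (3 * r\<^sup>2) - 3 * c * ln (r\<^sup>2) + 3 * k * r\<^sup>2 + excess ?x"
    unfolding lnd lnq unfolding z kd kz[of "centre_disp ?x"] excess_def vertex_excess_def by (simp add: algebra_simps)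
  finally show ?thesis .
qed

end

section \<open>Strict minimality at the equilibrium and the stability proof\<close>

lemma nform_p: "nform p = of_real (9 * r^4)"
proof -
  have s: "(\<Sum>m\<in>UNIV. cnj (z0 m) * z0 m) = of_real (3 * r\<^sup>2)"
    by (simp add: sum_4 power2_eq_square \<omega>_simps mult_ac)
  have "nform p = (\<Sum>m\<in>UNIV. cnj (z0 m) * z0 m) * (\<Sum>l\<in>UNIV. cnj (z0 l) * z0 l)"
    unfolding sum_product nform_def ment_p by (simp add: mult_ac)
  then show ?thesis unfolding s by (simp add: power2_eq_square power4_eq_xxxx)
qed

lemma params_p: "params p = 0"
proof -
  have q: "sqrt (Re (nform p)) = 3 * r\<^sup>2"
    unfolding nform_p using r_sq by (intro real_sqrt_unique) (auto simp: power2_eq_square power4_eq_xxxx)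
  have s: "(\<Sum>l\<in>UNIV. cnj (z0 l) * z0 l) = of_real (3 * r\<^sup>2)"
    by (simp add: sum_4 power2_eq_square \<omega>_simps mult_ac)
  have "zeta p i = z0 i * (\<Sum>l\<in>UNIV. cnj (z0 l) * z0 l) / of_real (3 * r\<^sup>2)" for i
    unfolding zeta_def q sum_distrib_left ment_p by (simp add: mult_ac)
  then have "zeta p i = z0 i" for i unfolding s using r0 by simp
  then show ?thesis unfolding params_def q zero_prod_def
    using r0 by (simp add: \<omega>_def complex_eq_iff)
qed

lemma params_continuous: "continuous_on {\<mu>. Re (nform \<mu>) > 0} params"
proof -
  have n: "continuous_on S nform" for S
    unfolding nform_def[abs_def] ment_def by (intro continuous_intros)
  have m: "continuous_on S (\<lambda>\<mu>. \<Sum>l\<in>UNIV. ment \<mu> i l * z0 l)" for S i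
    unfolding ment_def by (intro continuous_intros)
  have z: "continuous_on {\<mu>. Re (nform \<mu>) > 0} (\<lambda>\<mu>. zeta \<mu> i)" for i
    unfolding zeta_def by (intro continuous_intros m n) simp
  show ?thesis
    unfolding params_def[abs_def] using r0 by (intro continuous_intros z n) simp_all
qed

text \<open>Minimality of \<open>excess\<close> at 0 is pulled back along \<open>params\<close>,
  which is continuous at p with value 0. Strictness survives because near p only p itself, among the
  skew-Hermitian matrices with vanishing minors, has parameters 0.\<close>

lemma local_min:
  "\<forall>\<^sub>F \<mu> in nhds p. \<mu> \<in> positive_domain \<and>
    (\<mu> \<in> skew_hermitian \<inter> vanishing_minors \<and> \<mu> \<noteq> p \<longrightarrow> lyapunov_fun c k \<mu> > lyapunov_fun c k p)"
proof -
  have op: "open {\<mu>. Re (nform \<mu>) > 0}"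
    unfolding nform_def ment_def by (intro open_Collect_less continuous_intros)
  have pin: "Re (nform p) > 0" using r0 by (simp add: nform_p)
  have "isCont params p"
    using params_continuous pin continuous_on_eq_continuous_at[OF op] by blast
  then have "filterlim params (nhds (params p)) (nhds p)"
    unfolding isCont_def tendsto_at_iff_tendsto_nhds .
  then have lim: "filterlim params (nhds 0) (nhds p)" unfolding params_p .
  have pm: "p \<in> vanishing_minors" using p_rank_one rank_one_subset_vanishing_minors by blast
  have "lyapunov_fun c k p = 3 * ln (1 - r\<^sup>2) - 3 * c * ln (3 * r\<^sup>2) - 3 * c * ln (r\<^sup>2) + 3 * k * r\<^sup>2
    + excess (params p)"
    by (rule lyapunov_fun_excess[OF p_skew pm pin p_positive_domain])
  moreover have "excess (params p) = 0"
    by (simp add: params_p zero_prod_def excess_def vertex_excess_def vertex_disp_def side_disp_def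
        spoke_disp_def centre_disp_def)
  ultimately have Lp: "lyapunov_fun c k p =
    3 * ln (1 - r\<^sup>2) - 3 * c * ln (3 * r\<^sup>2) - 3 * c * ln (r\<^sup>2) + 3 * k * r\<^sup>2" by simp
  have "\<forall>\<^sub>F \<mu> in nhds p. \<mu> \<in> positive_domain"
    using open_positive_domain p_positive_domain by (rule eventually_nhds_in_open)
  moreover have "\<forall>\<^sub>F \<mu> in nhds p. Re (nform \<mu>) > 0"
    using eventually_nhds_in_open[OF op, of p] pin by simp
  moreover have "\<forall>\<^sub>F \<mu> in nhds p. params \<mu> \<noteq> 0 \<longrightarrow> excess (params \<mu>) > 0"
    using lim excess_pos by (rule filterlim_iff[THEN iffD1, rule_format])
  ultimately show ?thesis
  proof eventually_elim
    case (elim \<mu>)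
    show ?case
    proof (intro conjI impI)
      assume \<mu>: "\<mu> \<in> skew_hermitian \<inter> vanishing_minors \<and> \<mu> \<noteq> p"
      then have "params \<mu> \<noteq> 0" using eq_p_if_params_zero elim(2) by blast
      then have "excess (params \<mu>) > 0" using elim(3) by simp
      then show "lyapunov_fun c k \<mu> > lyapunov_fun c k p"
        using lyapunov_fun_excess[OF _ _ elim(2) elim(1)] \<mu> Lp by simp
    qed (rule elim(1))
  qed
qed

lemma triangle_lyapunov_stable:
  assumes \<Gamma>: "\<sigma> = 1 \<or> \<sigma> = -1" "\<And>i. \<Gamma> $ i = \<sigma>"
  shows "lyapunov_stable (relative_field c \<Gamma>) phase_domain rank_one p"
proof -
  obtain e where e: "e > 0" "\<And>\<mu>. dist \<mu> p < e \<Longrightarrow> \<mu> \<in> positive_domain"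
    "\<And>\<mu>. dist \<mu> p < e \<Longrightarrow> \<mu> \<in> skew_hermitian \<inter> vanishing_minors \<Longrightarrow> \<mu> \<noteq> p \<Longrightarrow>
      lyapunov_fun c k \<mu> > lyapunov_fun c k p"
    using local_min unfolding eventually_nhds_metric by blast
  \<comment> \<open>The radius is halved so that the closed ball lies in the open ball of radius e,
    where \<open>local_min\<close> gives information.\<close>
  define K where "K = cball p (e/2) \<inter> skew_hermitian"
  have K: "compact K" "K \<subseteq> positive_domain" "K \<subseteq> phase_domain"
    using e(1,2) closed_subspace[OF subspace_skew_hermitian]
    by (auto simp: K_def phase_domain_eq dist_commute compact_Int_closed)
  have pU: "p \<in> phase_domain" using p_positive_domain p_skew by (simp add: phase_domain_eq)
  have fld: "relative_field c \<Gamma> \<mu> = \<sigma> *\<^sub>R commutator (energy_grad c \<mu>) \<mu>" if "\<mu> \<in> phase_domain" for \<mu>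
    using relative_field_eq[OF \<Gamma> that] .
  obtain L where "L-lipschitz_on K (\<lambda>\<mu>. \<sigma> *\<^sub>R commutator (energy_grad c \<mu>) \<mu>)"
    using commutator_field_lipschitz[OF K(1,2)] by blast
  then have L: "L-lipschitz_on K (relative_field c \<Gamma>)"
    by (rule lipschitz_on_transform) (use K fld in auto)
  show ?thesis
  proof (rule lyapunov_stable_if_conserved[where V = "lyapunov_fun c k" and ?\<rho>0.0 = "e/2" and S' = vanishing_minors and L = L])
    show "subspace (skew_hermitian :: cmat4 set)" by (rule subspace_skew_hermitian)
    show "phase_domain \<subseteq> skew_hermitian" by (auto simp: phase_domain_eq)
    show "p \<in> phase_domain \<inter> rank_one" using pU p_rank_one by simp
    show "relative_field c \<Gamma> p = 0" by (simp add: fld pU commutator_p)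
    show "rank_one \<subseteq> vanishing_minors" by (rule rank_one_subset_vanishing_minors)
    show "closed (vanishing_minors :: cmat4 set)" by (rule closed_vanishing_minors)
    show "e / 2 > 0" using e by simp
    show "cball p (e/2) \<inter> skew_hermitian \<subseteq> phase_domain" using K by (simp add: K_def)
    show "relative_field c \<Gamma> \<mu> \<in> skew_hermitian" if "\<mu> \<in> phase_domain" for \<mu>
      unfolding fld[OF that] using that
      by (intro subspace_scale subspace_skew_hermitian skew_hermitian_commutator energy_grad_skew)
        (simp add: phase_domain_eq)
    show "L-lipschitz_on (cball p (e/2) \<inter> skew_hermitian) (relative_field c \<Gamma>)"
      using L by (simp add: K_def)
    show "x b \<in> vanishing_minors \<and> lyapunov_fun c k (x b) = lyapunov_fun c k (x 0)"
      if "b \<ge> 0" "ode_solution (relative_field c \<Gamma>) phase_domain {0..b} x" "x 0 \<in> vanishing_minors" for x b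
      using vanishing_minors_conserved[OF \<Gamma> that(2,1,3)] lyapunov_fun_conserved[OF \<Gamma> that(2,1)] by simp
    have "continuous_on positive_domain (log_energy c)"
      by (intro has_derivative_continuous_on[OF has_derivative_at_withinI[OF log_energy_derivative]])
    then show "continuous_on (cball p (e/2) \<inter> skew_hermitian) (lyapunov_fun c k)"
      unfolding lyapunov_fun_def[abs_def] using K
      by (intro continuous_intros) (auto simp: K_def intro: continuous_on_subset)
    show "lyapunov_fun c k q > lyapunov_fun c k p"
      if "q \<in> cball p (e/2) \<inter> skew_hermitian \<inter> vanishing_minors" "q \<noteq> p" for q
      using that e(1) by (intro e(3)) (auto simp: dist_commute)
  qed
qed

end

theorem proposition3p2:
  fixes c r :: real and \<Gamma> :: "real^4"
  assumes "c > 0" and "0 < r" and "r < 1"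
    and "(\<forall>i. \<Gamma> $ i = 1) \<or> (\<forall>i. \<Gamma> $ i = -1)"
    and "2 * r^4 - c * (1 - r\<^sup>2) * (2 - 3 * r\<^sup>2) < 0"
  shows "lyapunov_stable (relative_field c \<Gamma>) phase_domain rank_one (triangle_with_center r)"
proof -
  interpret triangle_params c r by unfold_locales (use assms in auto)
  obtain \<sigma> :: real where "\<sigma> = 1 \<or> \<sigma> = -1" "\<And>i. \<Gamma> $ i = \<sigma>" using assms(4) by blast
  then show ?thesis by (rule triangle_lyapunov_stable)
qed

end
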